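(* Let $C(p)$ be the steady-state expected cost of a customer in the two-queue exhaustive polling system without information when every arriving customer independently joins queue 1 with probability $p$ and queue 2 with probability $1-p$. A policy $p\in[0,1]$ is socially optimal if it minimizes $C$ over $[0,1]$. Then: (i) If $c>d$, there is a unique socially optimal policy, namely $p=\tfrac12$. (ii) If $c=d$, all policies $p\in[0,1]$ are socially optimal. (iii) If $c<d$, there are exactly two socially optimal policies: $p=0$ and $p=1$.
   Context: Polling model: customers arrive according to a Poisson process with rate $\lambda>0$ at a system with two queues. Service times are independent and exponentially distributed with rate $\mu$ in each queue, and $\rho=\lambda/\mu<1$. A single server serves the two queues cyclically with exhaustive service: it serves a queue until that queue is empty and then moves to the other queue. Switch-over times are zero, so the server is never idle while customers are present. Within a queue, service is in order of arrival. The queue where the server is located is called the busy queue, the other one the idle queue. A customer pays cost at rate $c$ per unit time while she is in a queue that is being served (including her own service), and at rate $d$ per unit time while she is in a queue that is not being served; here $c>0$, $d\ge 0$. No information: arriving customers know neither the server position nor the queue lengths, so a policy is a number $p\in[0,1]$: each customer independently joins queue 1 with probability $p$ and queue 2 with probability $1-p$. For $i=1,2$, let $C_i(p)$ be the expected total cost of a customer who arrives at the system in steady state (under the policy $p$ followed by all other customers) and joins queue $i$. The expected cost of a customer in steady state is $C(p)=p\,C_1(p)+(1-p)\,C_2(p)$. *)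

theory Defs
  imports "HOL-Probability.Probability"
begin

datatype queue = Q1 | Q2

fun other :: "queue \<Rightarrow> queue" where
  "other Q1 = Q2"
| "other Q2 = Q1"

text \<open>A state of the system is the position of the server together with the number of
  customers in each queue (the one in service included).  When the whole system is empty the
  server stays at the queue it served last; as switch-over times are zero, this is immaterial.\<close>

type_synonym system = "queue \<times> (queue \<Rightarrow> nat)"

datatype event = Arrive queue | Complete

text \<open>Exhaustive service with zero switch-over times: the server leaves its queue at the moment
  that queue has run empty, provided there is a customer in the other one.\<close>

fun settle :: "system \<Rightarrow> system" where
  "settle (s, n) = (if n s = 0 \<and> 0 < n (other s) then (other s, n) else (s, n))"

fun step :: "event \<Rightarrow> system \<Rightarrow> system" where
  "step (Arrive q) (s, n) = settle (s, n(q := n q + 1))"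
| "step Complete (s, n) = settle (s, n(s := n s - 1))"

fun queue_prob :: "real \<Rightarrow> queue \<Rightarrow> real" where
  "queue_prob p Q1 = p"
| "queue_prob p Q2 = 1 - p"

fun event_rate :: "real \<Rightarrow> real \<Rightarrow> real \<Rightarrow> system \<Rightarrow> event \<Rightarrow> real" where
  "event_rate lam mu p (s, n) (Arrive q) = lam * queue_prob p q"
| "event_rate lam mu p (s, n) Complete = (if 0 < n s then mu else 0)"

definition transition_rate :: "real \<Rightarrow> real \<Rightarrow> real \<Rightarrow> system \<Rightarrow> system \<Rightarrow> real" where
  "transition_rate lam mu p x y =
     (\<Sum>e | e \<in> {Arrive Q1, Arrive Q2, Complete} \<and> step e x = y. event_rate lam mu p x e)"

definition exit_rate :: "real \<Rightarrow> real \<Rightarrow> real \<Rightarrow> system \<Rightarrow> real" where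
  "exit_rate lam mu p x = (\<Sum>e\<in>{Arrive Q1, Arrive Q2, Complete}. event_rate lam mu p x e)"

text \<open>Global balance equations of the continuous-time Markov chain of system states.  No event
  with positive rate leaves the state unchanged, so \<open>exit_rate\<close> counts genuine jumps only.\<close>

definition stationary :: "real \<Rightarrow> real \<Rightarrow> real \<Rightarrow> system pmf \<Rightarrow> bool" where
  "stationary lam mu p \<pi> \<longleftrightarrow>
     (\<forall>y. pmf \<pi> y * exit_rate lam mu p y =
          measure_pmf.expectation \<pi> (\<lambda>x. transition_rate lam mu p x y))"

definition steady_state :: "real \<Rightarrow> real \<Rightarrow> real \<Rightarrow> system pmf" where
  "steady_state lam mu p = (THE \<pi>. stationary lam mu p \<pi>)"

text \<open>A tagged customer in queue \<open>i\<close>: the second component is the number of customers ahead of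
  her in queue \<open>i\<close>, which decreases at each service completion there (service in order of
  arrival), and \<open>None\<close> once she has left.\<close>

type_synonym tagged = "system \<times> nat option"

fun join :: "queue \<Rightarrow> system \<Rightarrow> tagged" where
  "join i (s, n) = (step (Arrive i) (s, n), Some (n i))"

fun tagged_step :: "queue \<Rightarrow> event \<Rightarrow> tagged \<Rightarrow> tagged" where
  "tagged_step i e ((s, n), a) =
     (step e (s, n),
      (case a of
         None \<Rightarrow> None
       | Some k \<Rightarrow>
           if e = Complete \<and> s = i then (if k = 0 then None else Some (k - 1)) else Some k))"

fun cost_rate :: "real \<Rightarrow> real \<Rightarrow> queue \<Rightarrow> tagged \<Rightarrow> real" where
  "cost_rate c d i ((s, n), a) =
     (case a of None \<Rightarrow> 0 | Some k \<Rightarrow> if s = i then c else d)"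

text \<open>By memorylessness of the exponential distribution, the time until the next arrival and the
  residual service time can be drawn afresh after each event.  A draw \<open>(u, v, q)\<close> consists of
  the time \<open>u\<close> until the next arrival, the remaining time \<open>v\<close> of the current service (without
  meaning if nobody is served), and the queue \<open>q\<close> that the next arriving customer joins.\<close>

type_synonym draw = "real \<times> real \<times> queue"

definition draw_measure :: "real \<Rightarrow> real \<Rightarrow> real \<Rightarrow> draw measure" where
  "draw_measure lam mu p =
     density lborel (exponential_density lam) \<Otimes>\<^sub>M
     (density lborel (exponential_density mu) \<Otimes>\<^sub>M
      measure_pmf (map_pmf (\<lambda>b. if b then Q1 else Q2) (bernoulli_pmf p)))"

fun next_event :: "system \<Rightarrow> draw \<Rightarrow> event" where
  "next_event (s, n) (u, v, q) = (if 0 < n s \<and> v < u then Complete else Arrive q)"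

fun holding_time :: "system \<Rightarrow> draw \<Rightarrow> real" where
  "holding_time (s, n) (u, v, q) = (if 0 < n s then min u v else u)"

primrec trajectory :: "queue \<Rightarrow> tagged \<Rightarrow> draw stream \<Rightarrow> nat \<Rightarrow> tagged" where
  "trajectory i z w 0 = z"
| "trajectory i z w (Suc k) =
     tagged_step i (next_event (fst (trajectory i z w k)) (w !! k)) (trajectory i z w k)"

definition total_cost :: "real \<Rightarrow> real \<Rightarrow> queue \<Rightarrow> tagged \<Rightarrow> draw stream \<Rightarrow> ennreal" where
  "total_cost c d i z w =
     (\<Sum>k. ennreal (cost_rate c d i (trajectory i z w k) *
                    holding_time (fst (trajectory i z w k)) (w !! k)))"

text \<open>The state found by a customer arriving in steady state has the stationary distribution
  (Poisson arrivals).\<close>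

definition queue_cost :: "real \<Rightarrow> real \<Rightarrow> real \<Rightarrow> real \<Rightarrow> queue \<Rightarrow> real \<Rightarrow> ennreal" where
  "queue_cost lam mu c d i p =
     (\<integral>\<^sup>+x. (\<integral>\<^sup>+w. total_cost c d i (join i x) w \<partial>stream_space (draw_measure lam mu p))
        \<partial>measure_pmf (steady_state lam mu p))"

definition expected_cost :: "real \<Rightarrow> real \<Rightarrow> real \<Rightarrow> real \<Rightarrow> real \<Rightarrow> ennreal" where
  "expected_cost lam mu c d p =
     ennreal p * queue_cost lam mu c d Q1 p + ennreal (1 - p) * queue_cost lam mu c d Q2 p"

definition socially_optimal :: "real \<Rightarrow> real \<Rightarrow> real \<Rightarrow> real \<Rightarrow> real \<Rightarrow> bool" where
  "socially_optimal lam mu c d p \<longleftrightarrow>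
     p \<in> {0..1} \<and> (\<forall>q\<in>{0..1}. expected_cost lam mu c d p \<le> expected_cost lam mu c d q)"

end

theory Submission
  imports Defs
begin

text \<open>Let \<open>lam\<^sub>i\<close> be the arrival rate of queue \<open>i\<close>, \<open>a\<^sub>i\<close> and \<open>b\<^sub>i\<close> the stationary mean number of
  customers in queue \<open>i\<close> while it is busy and while it is idle, and \<open>j\<close> the other queue.  Applying
  the generator of the chain to \<open>n\<^sub>i\<^sup>2\<close> and to \<open>n\<^sub>i n\<^sub>j\<close> restricted to the times when \<open>i\<close> is idle
  gives the closed linear system \<open>mu a\<^sub>i = lam\<^sub>i (a\<^sub>i + b\<^sub>i + 1)\<close>, \<open>(mu - lam\<^sub>j) b\<^sub>i = lam\<^sub>i a\<^sub>j\<close>.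
  A tagged customer waits for the end of the busy period of queue \<open>j\<close>, of mean
  \<open>n\<^sub>j / (mu - lam\<^sub>j)\<close>, and is then served after \<open>k\<close> others, which costs \<open>c (k + 1) / mu\<close>.
  Hence the expected cost is \<open>c / (mu - lam) + (d - c) (b\<^sub>1 + b\<^sub>2) / lam\<close>, where \<open>b\<^sub>1 + b\<^sub>2\<close> is a
  strictly increasing function of \<open>p (1 - p)\<close>.

  The stationary distribution exists because the total number of customers is an M/M/1 queue: if it
  starts geometric it stays geometric, so the laws of the chain are dominated by a summable
  function.  It is unique because an empty state can be reached from everywhere.\<close>

section \<open>Invariant distributions of kernels on countable sets\<close>

lemma integral_pmf_count_space:
  fixes f :: "'a \<Rightarrow> real"
  shows "(\<integral>x. f x \<partial>measure_pmf M) = (\<integral>x. pmf M x * f x \<partial>count_space UNIV)"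
  by (simp add: measure_pmf_eq_density integral_density)

lemma integrable_pmf_count_space:
  fixes f :: "'a \<Rightarrow> real"
  shows "integrable (measure_pmf M) f \<longleftrightarrow> integrable (count_space UNIV) (\<lambda>x. pmf M x * f x)"
  by (simp add: measure_pmf_eq_density integrable_density)

text \<open>Summing \<open>M - N\<close> against \<open>f\<close> gives 0, since both distributions
  are invariant. No term of that sum is negative: on \<open>A\<close> both factors are nonnegative,
  off \<open>A\<close> both are nonpositive. So every term vanishes, and the kernel cannot leave
  \<open>A\<close> from a point of \<open>A\<close>.\<close>

lemma invariant_pmf_closed:
  fixes K :: "'a \<Rightarrow> 'a pmf"
  assumes M: "bind_pmf M K = M" and N: "bind_pmf N K = N"
    and x: "pmf N x < pmf M x" and y: "y \<in> set_pmf (K x)"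
  shows "pmf N y < pmf M y"
proof -
  define A where "A = {x. pmf N x < pmf M x}"
  define f where "f z = indicator A z - measure_pmf.prob (K z) A" for z
  have bnd: "\<bar>f z\<bar> \<le> 1" for z
    using measure_pmf.prob_le_1[of "K z" A] measure_nonneg[of "measure_pmf (K z)" A]
    by (auto simp: f_def indicator_def simp del: measure_nonneg)
  have int: "integrable (measure_pmf Q) f" for Q
    by (rule measure_pmf.integrable_const_bound[where B=1]) (use bnd in auto)
  have zero: "(\<integral>x. f x \<partial>measure_pmf Q) = 0" if "bind_pmf Q K = Q" for Q
  proof -
    have "ennreal (measure_pmf.prob Q A) = (\<integral>\<^sup>+x. ennreal (measure_pmf.prob (K x) A) \<partial>Q)"
      by (subst that[symmetric]) (simp add: measure_pmf.emeasure_eq_measure[symmetric] del: ennreal_eq_zero_iff)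
    also have "\<dots> = ennreal (\<integral>x. measure_pmf.prob (K x) A \<partial>Q)"
      by (intro nn_integral_eq_integral measure_pmf.integrable_const_bound[where B=1]) auto
    finally have "measure_pmf.prob Q A = (\<integral>x. measure_pmf.prob (K x) A \<partial>Q)"
      by (subst (asm) ennreal_inj) (auto intro!: integral_nonneg_AE)
    moreover have "(\<integral>x. f x \<partial>Q) = (\<integral>x. indicator A x \<partial>Q) - (\<integral>x. measure_pmf.prob (K x) A \<partial>Q)"
      unfolding f_def
      by (intro Bochner_Integration.integral_diff measure_pmf.integrable_const_bound[where B=1]) auto
    ultimately show ?thesis by simp
  qed
  define h where "h z = pmf M z * f z - pmf N z * f z" for z
  have h_int: "integrable (count_space UNIV) h"
    unfolding h_def using int by (intro Bochner_Integration.integrable_diff)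
      (simp_all add: integrable_pmf_count_space)
  have "(\<integral>z. h z \<partial>count_space UNIV) = (\<integral>x. f x \<partial>M) - (\<integral>x. f x \<partial>N)"
    unfolding h_def using int[of M] int[of N]
    by (subst Bochner_Integration.integral_diff)
      (simp_all add: integrable_pmf_count_space integral_pmf_count_space)
  hence h0: "(\<integral>z. h z \<partial>count_space UNIV) = 0" using zero M N by simp
  have h_nonneg: "0 \<le> h z" for z
  proof (cases "z \<in> A")
    case True
    then have "0 \<le> f z" "pmf N z < pmf M z" by (auto simp: f_def A_def)
    then show ?thesis unfolding h_def by (simp add: mult_right_mono)
  next
    case False
    then have "f z \<le> 0" "pmf M z \<le> pmf N z" by (auto simp: f_def A_def)
    then show ?thesis unfolding h_def by (simp add: mult_right_mono_neg)
  qed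
  have "h x = 0"
    using integral_nonneg_eq_0_iff_AE[OF h_int] h_nonneg h0 by (simp add: AE_count_space)
  then have "f x = 0" using x by (auto simp: h_def)
  then have "measure_pmf.prob (K x) A = 1" using x by (auto simp: f_def A_def)
  then have "AE z in K x. z \<in> A" by (subst (asm) measure_pmf.prob_eq_1) auto
  then show ?thesis using y by (auto simp: AE_measure_pmf_iff A_def)
qed

text \<open>Two distinct probability mass functions exceed each other somewhere, as both sum to 1.
  \<open>invariant_pmf_closed\<close> carries both strict inequalities along paths to
  \<open>z\<close>, where they contradict each other.\<close>

lemma invariant_pmf_unique:
  fixes K :: "'a \<Rightarrow> 'a pmf"
  assumes M: "bind_pmf M K = M" and N: "bind_pmf N K = N"
    and reach: "\<And>x. (x, z) \<in> {(x, y). y \<in> set_pmf (K x)}\<^sup>*"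
  shows "M = N"
proof (rule ccontr)
  have *: "pmf Q z < pmf P z"
    if "bind_pmf P K = P" "bind_pmf Q K = Q" "pmf Q x < pmf P x" for P Q x
    using reach[of x] that(3)
    by (induction rule: rtrancl_induct) (auto intro: invariant_pmf_closed[OF that(1,2)])
  assume "M \<noteq> N"
  then obtain x where "pmf M x < pmf N x" using pmf_neq_exists_less by blast
  moreover obtain y where "pmf N y < pmf M y" using \<open>M \<noteq> N\<close> pmf_neq_exists_less by metis
  ultimately show False using *[OF M N] *[OF N M] by force
qed

text \<open>The Cesaro averages of the chain are tight because of the summable bound; a pointwise limit
  along a subsequence is the invariant distribution.\<close>

lemma invariant_pmf_exists:
  fixes K :: "'a::countable \<Rightarrow> 'a pmf" and M :: "nat \<Rightarrow> 'a pmf"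
  assumes step: "\<And>t. M (Suc t) = bind_pmf (M t) K"
    and le: "\<And>t x. pmf (M t) x \<le> G x" and G: "integrable (count_space UNIV) G"
  obtains \<pi> where "bind_pmf \<pi> K = \<pi>" "\<And>x. pmf \<pi> x \<le> G x"
proof -
  define A where "A T x = (\<Sum>t\<le>T. pmf (M t) x) / real (Suc T)" for T x
  have A_bnd: "A T x \<le> c" if "\<And>t. pmf (M t) x \<le> c" for T x c
    using sum_bounded_above[of "{..T}" "\<lambda>t. pmf (M t) x" c] that
    by (simp add: A_def field_simps)
  have A_G: "A T x \<le> G x" and A_1: "A T x \<le> 1" and A_0: "0 \<le> A T x" for T x
    by (auto intro!: A_bnd le pmf_le_1) (simp add: A_def sum_nonneg)
  \<comment> \<open>Countability of \<open>'a\<close> makes the function space metrizable, so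
    compactness of the cube yields convergent subsequences.\<close>
  have "compact (PiE UNIV (\<lambda>_. {0..1}) :: ('a \<Rightarrow> real) set)"
    using compactin_PiE[of "\<lambda>_::'a. euclideanreal" UNIV "\<lambda>_. {0..1}"]
    by (simp add: euclidean_product_topology)
  moreover have "A T \<in> PiE UNIV (\<lambda>_. {0..1})" for T using A_0 A_1 by auto
  ultimately obtain L r where r: "strict_mono r" and L: "(A \<circ> r) \<longlonglongrightarrow> L"
    unfolding compact_def by metis
  have lim: "(\<lambda>n. A (r n) x) \<longlonglongrightarrow> L x" for x
    using continuous_on_tendsto_compose[OF continuous_on_product_coordinates[of x] L] by (simp add: o_def)
  have L_0: "0 \<le> L x" and L_G: "L x \<le> G x" for x
    using LIMSEQ_le_const[OF lim] LIMSEQ_le_const2[OF lim] A_0 A_G by blast+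
  \<comment> \<open>Limits pass under the sum, with dominating function \<open>G\<close>. Taking
    \<open>k = 1\<close> shows that no mass escapes; \<open>k x = pmf (K x) y\<close> gives
    invariance.\<close>
  have dom: "(\<lambda>n. \<integral>x. A (r n) x * k x \<partial>count_space UNIV) \<longlonglongrightarrow> (\<integral>x. L x * k x \<partial>count_space UNIV)"
    if k: "\<And>x. 0 \<le> k x" "\<And>x. k x \<le> 1" for k
  proof (rule integral_dominated_convergence[where w=G])
    show "AE x in count_space UNIV. norm (A (r n) x * k x) \<le> G x" for n
      using mult_mono[OF A_G k(2) _ k(1)] A_0 k order_trans[OF A_0 A_G]
      by (auto simp: AE_count_space abs_mult)
  qed (auto simp: AE_count_space G intro!: tendsto_intros lim)
  have A_int: "(\<integral>x. A T x * k x \<partial>count_space UNIV) = (\<Sum>t\<le>T. \<integral>x. k x \<partial>M t) / real (Suc T)"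
    if k: "\<And>x. 0 \<le> k x" "\<And>x. k x \<le> (1::real)" for k T
  proof -
    have "integrable (count_space UNIV) (\<lambda>x. pmf (M t) x * k x)" for t
      using k by (auto simp flip: integrable_pmf_count_space
          intro!: measure_pmf.integrable_const_bound[where B=1])
    then show ?thesis
      by (simp add: A_def sum_distrib_right integral_pmf_count_space)
  qed
  have "(\<lambda>n. 1) \<longlonglongrightarrow> (\<integral>x. L x \<partial>count_space UNIV)"
    using dom[of "\<lambda>_. 1"] A_int[of "\<lambda>_. 1"] by simp
  then have sum1: "(\<integral>x. L x \<partial>count_space UNIV) = 1"
    using LIMSEQ_unique tendsto_const by blast
  have L_int: "integrable (count_space UNIV) L"
    by (rule Bochner_Integration.integrable_bound[OF G])
      (use L_0 L_G in \<open>auto simp: AE_count_space intro: order_trans[OF _ abs_ge_self]\<close>)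
  have "(\<integral>\<^sup>+x. ennreal (L x) \<partial>count_space UNIV) = 1"
    using nn_integral_eq_integral[OF L_int] L_0 sum1 by simp
  then have pmf_L: "pmf (embed_pmf L) x = L x" for x
    using L_0 by (simp add: pmf_embed_pmf)
  have "bind_pmf (embed_pmf L) K = embed_pmf L"
  proof (rule pmf_eqI)
    fix y
    have "(\<lambda>n. \<integral>x. A (r n) x * pmf (K x) y \<partial>count_space UNIV)
        \<longlonglongrightarrow> (\<integral>x. L x * pmf (K x) y \<partial>count_space UNIV)"
      by (rule dom) (auto simp: pmf_le_1)
    \<comment> \<open>Applying the kernel shifts the time index by one, so the averages before and
      after differ by the two boundary terms only.\<close>
    moreover have "(\<integral>x. A T x * pmf (K x) y \<partial>count_space UNIV)
        = A T y + (pmf (M (Suc T)) y - pmf (M 0) y) / real (Suc T)" for T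
    proof -
      have "(\<integral>x. A T x * pmf (K x) y \<partial>count_space UNIV)
          = (\<Sum>t\<le>T. pmf (M (Suc t)) y) / real (Suc T)"
        by (subst A_int) (auto simp: pmf_le_1 step pmf_bind)
      also have "(\<Sum>t\<le>T. pmf (M (Suc t)) y) = (\<Sum>t\<le>T. pmf (M t) y) + (pmf (M (Suc T)) y - pmf (M 0) y)"
        by (induction T) auto
      finally show ?thesis by (simp add: A_def add_divide_distrib)
    qed
    moreover have "(\<lambda>n. (pmf (M (Suc (r n))) y - pmf (M 0) y) / real (Suc (r n))) \<longlonglongrightarrow> 0"
    proof (rule Lim_null_comparison)
      show "\<forall>\<^sub>F n in sequentially. norm ((pmf (M (Suc (r n))) y - pmf (M 0) y) / real (Suc (r n)))
          \<le> 1 / real (Suc (r n))"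
        using pmf_le_1 pmf_nonneg
        by (intro always_eventually allI) (simp add: divide_simps abs_le_iff, smt (verit) pmf_le_1 pmf_nonneg)
      show "(\<lambda>n. 1 / real (Suc (r n))) \<longlonglongrightarrow> 0"
        using LIMSEQ_subseq_LIMSEQ[OF LIMSEQ_inverse_real_of_nat r]
        by (simp add: o_def inverse_eq_divide)
    qed
    ultimately have "(\<lambda>n. A (r n) y) \<longlonglongrightarrow> (\<integral>x. L x * pmf (K x) y \<partial>count_space UNIV)"
      using tendsto_diff by fastforce
    then show "pmf (bind_pmf (embed_pmf L) K) y = pmf (embed_pmf L) y"
      using LIMSEQ_unique[OF lim] by (simp add: pmf_bind integral_pmf_count_space pmf_L)
  qed
  then show ?thesis using that L_G by (simp add: pmf_L)
qed

section \<open>The uniformized chain\<close>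

instance queue :: countable
  by countable_datatype

text \<open>Finiteness of \<open>queue\<close> makes \<open>queue \<Rightarrow> nat\<close>
  countable, and hence the system states and the tagged states as well.\<close>

instance queue :: finite
proof
  have "(UNIV :: queue set) = {Q1, Q2}" using queue.exhaust by auto
  then show "finite (UNIV :: queue set)" by (metis finite.emptyI finite.insertI)
qed

instance event :: countable
  by countable_datatype

lemma UNIV_event: "(UNIV :: event set) = {Arrive Q1, Arrive Q2, Complete}"
  by (auto, metis event.exhaust queue.exhaust)

lemma other_other [simp]: "other (other q) = q"
  by (cases q) auto

lemma other_neq [simp]: "other q \<noteq> q" "q \<noteq> other q"
  by (cases q; simp)+

lemma eq_other_iff: "s = other q \<longleftrightarrow> s \<noteq> q"
  by (cases s; cases q) auto

text \<open>Uniformization: potential events occur at the constant rate \<open>lam + mu\<close>, so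
  their law does not depend on the state. A completion at an empty queue is fictitious, and
  \<open>uniformized_step\<close> turns it into a self-loop.\<close>

definition event_pmf :: "real \<Rightarrow> real \<Rightarrow> real \<Rightarrow> event pmf" where
  "event_pmf lam mu p = bind_pmf (bernoulli_pmf (lam / (lam + mu)))
     (\<lambda>b. if b then map_pmf (\<lambda>b. Arrive (if b then Q1 else Q2)) (bernoulli_pmf p)
          else return_pmf Complete)"

definition uniformized_step :: "event \<Rightarrow> system \<Rightarrow> system" where
  "uniformized_step e x = (if e = Complete \<and> snd x (fst x) = 0 then x else step e x)"

definition kernel :: "real \<Rightarrow> real \<Rightarrow> real \<Rightarrow> system \<Rightarrow> system pmf" where
  "kernel lam mu p x = map_pmf (\<lambda>e. uniformized_step e x) (event_pmf lam mu p)"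

definition total :: "system \<Rightarrow> nat" where
  "total x = snd x Q1 + snd x Q2"

text \<open>A server at an empty queue means an empty system. Every \<open>step\<close> ends in such
  a state, although the type \<open>system\<close> contains others.\<close>

definition settled :: "system \<Rightarrow> bool" where
  "settled x \<longleftrightarrow> snd x (fst x) = 0 \<longrightarrow> snd x (other (fst x)) = 0"

lemma total_eq: "total x = snd x i + snd x (other i)"
  by (cases i) (auto simp: total_def)

lemma settled_step: "settled (step e x)"
  by (cases "(e, x)" rule: step.cases) (auto simp: settled_def)

lemma total_step_Arrive: "total (step (Arrive q) x) = Suc (total x)"
  by (cases x; cases q) (auto simp: total_def)

lemma total_step_Complete: "0 < snd x (fst x) \<Longrightarrow> total (step Complete x) = total x - 1"
  by (cases x; cases "fst x") (auto simp: total_def)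

lemma settled_uniformized_step: "settled x \<Longrightarrow> settled (uniformized_step e x)"
  by (simp add: uniformized_step_def settled_step)

text \<open>In a settled state a fictitious completion can only occur when the system is empty, and
  there truncated subtraction gives \<open>0 - 1 = 0\<close>. Thus the total moves like an M/M/1
  queue, whatever the routing.\<close>

lemma total_uniformized_step:
  assumes "settled x"
  shows "total (uniformized_step e x) = (case e of Arrive q \<Rightarrow> Suc (total x) | Complete \<Rightarrow> total x - 1)"
  using assms total_step_Complete[of x] total_eq[of x "fst x"]
  by (auto simp: uniformized_step_def total_step_Arrive settled_def split: event.splits)

text \<open>With load \<open>r\<close>, the uniformized M/M/1 walk goes up with probability
  \<open>r / (1 + r)\<close>, and a down step from 0 stays at 0. Every state has exactly two
  predecessors (0 and 1 for state 0), so each balance equation is a sum of two terms.\<close>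

lemma mm1_invariant:
  fixes r :: real
  assumes r: "0 < r" "r < 1"
  shows "bind_pmf (geometric_pmf (1 - r))
    (\<lambda>k. map_pmf (\<lambda>b. if b then Suc k else k - 1) (bernoulli_pmf (r / (1 + r)))) = geometric_pmf (1 - r)"
    (is "bind_pmf ?g ?K = _")
proof (rule pmf_eqI)
  fix j
  have K: "pmf (?K k) j = r / (1 + r) * of_bool (Suc k = j) + 1 / (1 + r) * of_bool (k - 1 = j)" for k j
    using r by (simp add: map_pmf_def pmf_bind indicator_def field_simps)
  show "pmf (bind_pmf ?g ?K) j = pmf ?g j"
  proof (cases j)
    case 0
    have "pmf (bind_pmf ?g ?K) j = (\<Sum>k\<in>{0,1}. pmf ?g k *\<^sub>R pmf (?K k) j)"
      unfolding pmf_bind by (rule integral_measure_pmf) (auto simp: K 0)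
    also have "\<dots> = (1 - r) * (1 + r) / (1 + r)" using r by (simp add: K 0 field_simps)
    finally show ?thesis using r by (simp add: 0)
  next
    case (Suc i)
    have "pmf (bind_pmf ?g ?K) j = (\<Sum>k\<in>{i, Suc (Suc i)}. pmf ?g k *\<^sub>R pmf (?K k) j)"
      unfolding pmf_bind
      by (rule integral_measure_pmf) (simp, simp add: K Suc of_bool_def split: if_splits)
    moreover have "pmf (?K i) j = r / (1 + r)" "pmf (?K (Suc (Suc i))) j = 1 / (1 + r)"
      by (simp_all only: K Suc) (auto simp: of_bool_def)
    ultimately have "pmf (bind_pmf ?g ?K) j
        = r ^ i * (1 - r) * (r / (1 + r)) + r ^ Suc (Suc i) * (1 - r) * (1 / (1 + r))"
      using r by simp
    also have "\<dots> = (1 - r) * r ^ i * r * ((1 + r) * (1 / (1 + r)))"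
      unfolding times_divide_eq_right[of r, symmetric]
      by (simp only: divide_inverse power_Suc) algebra
    also have "\<dots> = (1 - r) * r ^ i * r" using r by simp
    finally show ?thesis using r by (simp add: Suc)
  qed
qed

text \<open>Up to a constant, \<open>r ^ total x\<close> is the mass function of a fair coin for the
  server and two independent geometric queue lengths, transported by the injection
  \<open>f\<close>.\<close>

lemma integrable_power_total:
  fixes r :: real
  assumes r: "0 < r" "r < 1"
  shows "integrable (count_space UNIV) (\<lambda>x. r ^ total x)"
proof -
  define f :: "bool \<times> nat \<times> nat \<Rightarrow> system" where
    "f = (\<lambda>(b, k, m). (if b then Q1 else Q2, \<lambda>q. case q of Q1 \<Rightarrow> k | Q2 \<Rightarrow> m))"
  let ?g = "geometric_pmf (1 - r)"
  let ?M = "map_pmf f (pair_pmf (bernoulli_pmf (1/2)) (pair_pmf ?g ?g))"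
  have "inj f"
  proof (rule injI)
    fix x y assume eq: "f x = f y"
    obtain b k m b' k' m' where xy: "x = (b, k, m)" "y = (b', k', m')" by (metis prod_cases3)
    have "case_queue k m = case_queue k' m'" using eq by (simp add: f_def xy)
    then have "k = k'" "m = m'" by (metis queue.case)+
    then show "x = y" using eq by (auto simp: f_def xy split: if_splits)
  qed
  have pmf_M: "pmf ?M x = (1 - r)\<^sup>2 / 2 * r ^ total x" for x
  proof -
    obtain s n where x: "x = (s, n)" by (cases x)
    have "x = f (s = Q1, n Q1, n Q2)"
      using queue.exhaust by (auto simp: f_def x fun_eq_iff split: queue.splits)
    then have "pmf ?M x = pmf (pair_pmf (bernoulli_pmf (1/2)) (pair_pmf ?g ?g)) (s = Q1, n Q1, n Q2)"
      using pmf_map_inj'[OF \<open>inj f\<close>] by metis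
    then show ?thesis
      using r by (simp add: pmf_pair x total_def power_add power2_eq_square)
  qed
  have eq: "r ^ total x = 2 / (1 - r)\<^sup>2 * pmf ?M x" for x
    using r unfolding pmf_M by simp
  show ?thesis unfolding eq by (intro integrable_mult_right integrable_pmf)
qed

section \<open>Balance equations, uniqueness and existence of the stationary law for a fixed
  policy\<close>

locale polling =
  fixes lam mu p :: real
  assumes lam: "0 < lam" and lam_mu: "lam < mu" and p: "0 \<le> p" "p \<le> 1"
begin

abbreviation "E \<equiv> event_pmf lam mu p"
abbreviation "K \<equiv> kernel lam mu p"
abbreviation "rate q \<equiv> lam * queue_prob p q"

lemma mu: "0 < mu" using lam lam_mu by simp

lemma queue_prob_nonneg: "0 \<le> queue_prob p q"
  using p by (cases q) auto

lemma rate_nonneg: "0 \<le> rate q"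
  using queue_prob_nonneg lam by simp

lemma rate_other: "rate (other q) = lam - rate q"
  by (cases q) (simp_all add: algebra_simps)

lemma rate_less: "rate q < mu"
  using rate_other[of q] rate_nonneg[of "other q"] lam_mu by simp

lemma pmf_event: "pmf E (Arrive q) = rate q / (lam + mu)" "pmf E Complete = mu / (lam + mu)"
  using lam mu p by (cases q; auto simp: event_pmf_def map_pmf_def pmf_bind indicator_def field_simps)+

lemma integral_event:
  "(\<integral>e. f e \<partial>E) = (rate i * f (Arrive i) + rate (other i) * f (Arrive (other i)) + mu * f Complete) / (lam + mu)"
  for f :: "event \<Rightarrow> real"
proof -
  have "(\<integral>e. f e \<partial>E) = (\<Sum>e\<in>{Arrive Q1, Arrive Q2, Complete}. pmf E e *\<^sub>R f e)"
    by (rule integral_measure_pmf) (use UNIV_event in blast)+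
  then show ?thesis by (cases i) (simp_all add: pmf_event add_divide_distrib)
qed

lemma pmf_kernel: "pmf (K x) y = (\<integral>e. of_bool (uniformized_step e x = y) \<partial>E)"
  unfolding kernel_def map_pmf_def pmf_bind
  by (intro Bochner_Integration.integral_cong) (auto simp: indicator_def)

text \<open>The kernel is the identity plus the generator divided by \<open>lam + mu\<close>. The
  diagonal correction is the rate of fictitious completions: \<open>mu\<close> if the server's queue
  is empty, and 0 otherwise.\<close>

lemma kernel_transition_rate:
  "(lam + mu) * pmf (K x) y = transition_rate lam mu p x y + of_bool (x = y) * (lam + mu - exit_rate lam mu p y)"
proof -
  have "transition_rate lam mu p x y
      = (\<Sum>e\<in>{Arrive Q1, Arrive Q2, Complete}. if step e x = y then event_rate lam mu p x e else 0)"
    unfolding transition_rate_def by (subst sum.inter_filter) auto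
  also have "\<dots> = rate Q1 * of_bool (step (Arrive Q1) x = y) + rate Q2 * of_bool (step (Arrive Q2) x = y)
      + (if 0 < snd x (fst x) then mu else 0) * of_bool (step Complete x = y)"
    by (cases x) simp
  finally have T: "transition_rate lam mu p x y = \<dots>" .
  have X: "exit_rate lam mu p x = lam + (if 0 < snd x (fst x) then mu else 0)"
    by (cases x) (simp add: exit_rate_def algebra_simps)
  have "(lam + mu) * pmf (K x) y = rate Q1 * of_bool (step (Arrive Q1) x = y)
      + rate Q2 * of_bool (step (Arrive Q2) x = y) + mu * of_bool (uniformized_step Complete x = y)"
    using lam mu unfolding pmf_kernel integral_event[where i=Q1] by (simp add: uniformized_step_def)
  then show ?thesis
    using X unfolding T by (cases "x = y"; cases "0 < snd x (fst x)") (simp_all add: uniformized_step_def)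
qed

text \<open>Integrating \<open>kernel_transition_rate\<close> over \<open>\<pi>\<close> makes the
  terms in \<open>lam + mu\<close> cancel; what remains is global balance.\<close>

lemma stationary_iff_invariant: "stationary lam mu p \<pi> \<longleftrightarrow> bind_pmf \<pi> K = \<pi>"
proof -
  have "(lam + mu) * pmf (bind_pmf \<pi> K) y
      = (\<integral>x. transition_rate lam mu p x y \<partial>\<pi>) + pmf \<pi> y * (lam + mu - exit_rate lam mu p y)" for y
  proof -
    have int: "integrable \<pi> (\<lambda>x. (lam + mu) * pmf (K x) y)"
      by (intro integrable_mult_right measure_pmf.integrable_const_bound[where B=1]) (auto simp: pmf_le_1)
    have int': "integrable \<pi> (\<lambda>x. of_bool (x = y) * (lam + mu - exit_rate lam mu p y))"
      by (intro integrable_mult_left measure_pmf.integrable_const_bound[where B=1]) auto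
    have "(\<integral>x. transition_rate lam mu p x y \<partial>\<pi>)
       = (\<integral>x. (lam + mu) * pmf (K x) y - of_bool (x = y) * (lam + mu - exit_rate lam mu p y) \<partial>\<pi>)"
      by (simp add: kernel_transition_rate)
    also have "\<dots> = (lam + mu) * pmf (bind_pmf \<pi> K) y
        - (\<integral>x. of_bool (x = y) * (lam + mu - exit_rate lam mu p y) \<partial>\<pi>)"
      using int int' by (simp add: pmf_bind)
    also have "(\<integral>x. of_bool (x = y) * (lam + mu - exit_rate lam mu p y) \<partial>\<pi>)
        = pmf \<pi> y * (lam + mu - exit_rate lam mu p y)"
      by (subst integral_measure_pmf[of "{y}"]) auto
    finally show ?thesis by simp
  qed
  moreover have "(lam + mu) * a = b + c * (lam + mu - d) \<Longrightarrow> c * d = b \<longleftrightarrow> (lam + mu) * a = (lam + mu) * c"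
    for a b c d :: real by (auto simp: algebra_simps)
  ultimately have "pmf \<pi> y * exit_rate lam mu p y = (\<integral>x. transition_rate lam mu p x y \<partial>\<pi>)
      \<longleftrightarrow> (lam + mu) * pmf (bind_pmf \<pi> K) y = (lam + mu) * pmf \<pi> y" for y
    by blast
  then show ?thesis
    using lam mu unfolding stationary_def pmf_eq_iff by simp
qed

lemma uniformized_step_in_kernel: "0 < pmf E e \<Longrightarrow> uniformized_step e x \<in> set_pmf (K x)"
  by (auto simp: kernel_def pmf_positive_iff)

lemma reachable_empty:
  assumes "settled x"
  shows "\<exists>s. (x, (s, \<lambda>_. 0)) \<in> {(x, y). y \<in> set_pmf (K x)}\<^sup>*"
  using assms
proof (induction "total x" arbitrary: x)
  case 0
  then have "snd x Q1 = 0" "snd x Q2 = 0" by (auto simp: total_def)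
  then have "snd x q = 0" for q by (cases q) auto
  then have "x = (fst x, \<lambda>_. 0)" by (auto simp: prod_eq_iff)
  then show ?case by (metis rtrancl.rtrancl_refl)
next
  case (Suc k)
  let ?y = "uniformized_step Complete x"
  have "total ?y = k" "settled ?y"
    using Suc.hyps(2) Suc.prems total_uniformized_step[of x Complete] settled_uniformized_step by auto
  then obtain s where "(?y, (s, \<lambda>_. 0)) \<in> {(x, y). y \<in> set_pmf (K x)}\<^sup>*"
    using Suc.hyps(1)[OF sym] by blast
  moreover have "(x, ?y) \<in> {(x, y). y \<in> set_pmf (K x)}"
    using uniformized_step_in_kernel[of Complete x] pmf_event(2) lam mu by simp
  ultimately show ?case by (intro exI) (rule converse_rtrancl_into_rtrancl)
qed

text \<open>An emptied system may leave the server at either queue, so a common target must fix the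
  position. A first arrival settles the state and completions empty it; one more arrival at
  \<open>q\<close> and its completion bring the server to \<open>q\<close>. For \<open>p = 0\<close>
  or \<open>p = 1\<close> only one queue qualifies as \<open>q\<close>.\<close>

lemma reachable_empty_at:
  assumes q: "0 < queue_prob p q"
  shows "(x, (q, \<lambda>_. 0)) \<in> {(x, y). y \<in> set_pmf (K x)}\<^sup>*"
proof -
  let ?R = "{(x, y). y \<in> set_pmf (K x)}"
  have arr: "(y, uniformized_step (Arrive q) y) \<in> ?R" for y
    using uniformized_step_in_kernel[of "Arrive q" y] pmf_event(1) lam mu q by simp
  have comp: "(y, uniformized_step Complete y) \<in> ?R" for y
    using uniformized_step_in_kernel[of Complete y] pmf_event(2) lam mu by simp
  have "settled (uniformized_step (Arrive q) x)"
    by (simp add: uniformized_step_def settled_step)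
  then obtain s where s: "(uniformized_step (Arrive q) x, (s, \<lambda>_. 0)) \<in> ?R\<^sup>*"
    using reachable_empty by blast
  have e: "uniformized_step (Arrive q) (s, \<lambda>_. 0) = (q, (\<lambda>_. 0)(q := 1))"
    by (cases s; cases q) (auto simp: uniformized_step_def)
  have f: "uniformized_step Complete (q, (\<lambda>_. 0)(q := 1)) = (q, \<lambda>_. 0)"
    by (auto simp: uniformized_step_def)
  show ?thesis
    using arr[of x] s arr[of "(s, \<lambda>_. 0)"] comp[of "(q, (\<lambda>_. 0)(q := 1))"] unfolding e f
    by (meson converse_rtrancl_into_rtrancl rtrancl.rtrancl_into_rtrancl)
qed

text \<open>Lumping: the law of the next total depends on the state through its total alone, so
  \<open>mm1_invariant\<close> applies to the image chain.\<close>

lemma map_total_kernel: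
  assumes "settled x"
  shows "map_pmf total (K x)
    = map_pmf (\<lambda>b. if b then Suc (total x) else total x - 1) (bernoulli_pmf (lam / (lam + mu)))"
proof -
  have "map_pmf total (K x)
      = map_pmf (\<lambda>e. case e of Arrive q \<Rightarrow> Suc (total x) | Complete \<Rightarrow> total x - 1) E"
    by (simp add: kernel_def map_pmf_comp total_uniformized_step[OF assms])
  also have "\<dots> = bind_pmf (bernoulli_pmf (lam / (lam + mu)))
      (\<lambda>b. return_pmf (if b then Suc (total x) else total x - 1))"
    unfolding event_pmf_def map_bind_pmf
    by (intro bind_pmf_cong) (auto simp: map_pmf_comp)
  finally show ?thesis by (simp add: map_pmf_def)
qed

text \<open>Started with a geometric number of customers, all in queue 1, the chain keeps a
  geometric total. A state is at most as likely as its level set of \<open>total\<close>, which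
  gives a bound uniform in time.\<close>

lemma invariant_exists:
  obtains \<pi> where "bind_pmf \<pi> K = \<pi>" "\<And>x. x \<in> set_pmf \<pi> \<Longrightarrow> settled x"
    "\<And>x. pmf \<pi> x \<le> (lam / mu) ^ total x"
proof -
  define r where "r = lam / mu"
  have r: "0 < r" "r < 1" using lam lam_mu mu by (auto simp: r_def)
  have r': "lam / (lam + mu) = r / (1 + r)" using lam mu by (simp add: r_def field_simps)
  define M where "M t = ((\<lambda>Q. bind_pmf Q K) ^^ t)
    (map_pmf (\<lambda>k. (Q1, \<lambda>q. if q = Q1 then k else 0)) (geometric_pmf (1 - r)))" for t
  \<comment> \<open>The factor \<open>of_bool (settled x)\<close> makes the limit distribution
    inherit settledness together with the decay.\<close>
  define G where "G x = of_bool (settled x) * r ^ total x" for x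
  have M_Suc: "M (Suc t) = bind_pmf (M t) K" for t by (simp add: M_def)
  have M: "map_pmf total (M t) = geometric_pmf (1 - r) \<and> (\<forall>x\<in>set_pmf (M t). settled x)" for t
  proof (induction t)
    case 0
    then show ?case by (auto simp: M_def map_pmf_comp total_def settled_def)
  next
    case (Suc t)
    have "map_pmf total (M (Suc t)) = bind_pmf (M t) (\<lambda>x. map_pmf (\<lambda>b. if b then Suc (total x) else total x - 1)
        (bernoulli_pmf (lam / (lam + mu))))"
      unfolding M_Suc map_bind_pmf using Suc by (intro bind_pmf_cong) (auto simp: map_total_kernel)
    also have "\<dots> = bind_pmf (map_pmf total (M t)) (\<lambda>k. map_pmf (\<lambda>b. if b then Suc k else k - 1)
        (bernoulli_pmf (r / (1 + r))))"
      by (simp add: bind_map_pmf r')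
    also have "\<dots> = geometric_pmf (1 - r)" using Suc mm1_invariant[OF r] by simp
    finally show ?case
      using Suc by (auto simp: M_Suc kernel_def intro: settled_uniformized_step)
  qed
  have "pmf (M t) x \<le> G x" for t x
  proof (cases "settled x")
    case True
    have "pmf (M t) x \<le> measure_pmf.prob (M t) (total -` {total x})"
      unfolding measure_pmf_single[symmetric] by (intro measure_pmf.finite_measure_mono) auto
    also have "\<dots> = pmf (map_pmf total (M t)) (total x)" by (simp add: pmf_map)
    also have "\<dots> = r ^ total x * (1 - r)" using M r by simp
    also have "\<dots> \<le> r ^ total x" using r by (simp add: mult_left_le)
    finally show ?thesis using True by (simp add: G_def)
  next
    case False
    then have "pmf (M t) x = 0" using M by (auto simp: pmf_eq_0_set_pmf)
    with False show ?thesis by (simp add: G_def)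
  qed
  moreover have "integrable (count_space UNIV) G"
    by (rule Bochner_Integration.integrable_bound[OF integrable_power_total[OF r]])
      (use r in \<open>auto simp: G_def AE_count_space\<close>)
  ultimately obtain \<pi> where \<pi>: "bind_pmf \<pi> K = \<pi>" "\<And>x. pmf \<pi> x \<le> G x"
    using invariant_pmf_exists[of M K G] M_Suc by blast
  have "settled x" if "x \<in> set_pmf \<pi>" for x
    using \<pi>(2)[of x] that by (cases "settled x") (auto simp: G_def set_pmf_iff)
  moreover have "pmf \<pi> x \<le> (lam / mu) ^ total x" for x
    using \<pi>(2)[of x] r by (cases "settled x") (auto simp: G_def r_def)
  ultimately show ?thesis using that \<pi>(1) by blast
qed

text \<open>Existence and uniqueness make the \<open>THE\<close> in the definition of
  \<open>steady_state\<close> well defined. At least one of \<open>p\<close> and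
  \<open>1 - p\<close> is positive, which supplies the queue \<open>q\<close> for
  \<open>reachable_empty_at\<close>.\<close>

lemma steady_state:
  shows steady_state_invariant: "bind_pmf (steady_state lam mu p) K = steady_state lam mu p"
    and steady_state_settled: "x \<in> set_pmf (steady_state lam mu p) \<Longrightarrow> settled x"
    and steady_state_le: "pmf (steady_state lam mu p) x \<le> (lam / mu) ^ total x"
proof -
  obtain q where q: "0 < queue_prob p q"
    using p queue_prob.simps by (metis diff_gt_0_iff_gt less_eq_real_def zero_less_one)
  obtain \<pi> where \<pi>: "bind_pmf \<pi> K = \<pi>" "\<And>x. x \<in> set_pmf \<pi> \<Longrightarrow> settled x"
    "\<And>x. pmf \<pi> x \<le> (lam / mu) ^ total x"
    using invariant_exists by blast
  have "steady_state lam mu p = \<pi>"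
    unfolding steady_state_def stationary_iff_invariant
    using invariant_pmf_unique[OF _ \<pi>(1) reachable_empty_at[OF q]] \<pi>(1) by blast
  with \<pi> show "bind_pmf (steady_state lam mu p) K = steady_state lam mu p"
    "x \<in> set_pmf (steady_state lam mu p) \<Longrightarrow> settled x"
    "pmf (steady_state lam mu p) x \<le> (lam / mu) ^ total x" by auto
qed

end

section \<open>Moments of the stationary distribution\<close>

lemma bounded_square_times_power:
  fixes q :: real
  assumes "0 \<le> q" "q < 1"
  obtains C where "\<And>n. ((real n + 1) * q ^ n)\<^sup>2 \<le> C"
proof -
  have "Bseq (\<lambda>n. real n * q ^ n)"
    using powser_times_n_limit_0[of q] assms by (intro convergent_imp_Bseq) (auto simp: convergent_def)
  then obtain B where B: "\<And>n. norm (real n * q ^ n) \<le> B" by (auto simp: Bseq_def)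
  have "((real n + 1) * q ^ n)\<^sup>2 \<le> (B + 1)\<^sup>2" for n
  proof (rule power_mono)
    show "(real n + 1) * q ^ n \<le> B + 1"
      using B[of n] power_le_one[of q n] assms by (simp add: ring_distribs)
  qed (use assms in auto)
  then show ?thesis using that by blast
qed

context polling
begin

abbreviation "S \<equiv> steady_state lam mu p"

lemma integrable_square_total: "integrable S (\<lambda>x. (real (total x) + 1)\<^sup>2)"
proof -
  \<comment> \<open>The load is \<open>q ^ 4\<close>. One factor
    \<open>(q\<^sup>2) ^ total x\<close> absorbs the quadratic growth, and the other one stays
    summable.\<close>
  define q where "q = sqrt (sqrt (lam / mu))"
  have q: "0 < q" "q < 1" and q4: "q\<^sup>2 * q\<^sup>2 = lam / mu"
    using lam lam_mu mu by (simp_all add: q_def)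
  obtain C where C: "\<And>n. ((real n + 1) * q ^ n)\<^sup>2 \<le> C"
    using bounded_square_times_power[of q] q by auto
  have "pmf S x * (real (total x) + 1)\<^sup>2 \<le> C * (q\<^sup>2) ^ total x" for x
  proof -
    have "pmf S x * (real (total x) + 1)\<^sup>2 \<le> (q\<^sup>2 * q\<^sup>2) ^ total x * (real (total x) + 1)\<^sup>2"
      using steady_state_le[of x] unfolding q4 by (intro mult_right_mono) auto
    also have "\<dots> = ((real (total x) + 1) * q ^ total x)\<^sup>2 * (q\<^sup>2) ^ total x"
      by (simp only: power_mult_distrib power_commutes[symmetric] power_mult[symmetric] mult_ac)
    also have "\<dots> \<le> C * (q\<^sup>2) ^ total x" using C by (intro mult_right_mono) auto
    finally show ?thesis .
  qed
  moreover have "integrable (count_space UNIV) (\<lambda>x. C * (q\<^sup>2) ^ total x)"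
    using q by (intro integrable_mult_right integrable_power_total) (auto simp: power_less_one_iff)
  moreover have "0 \<le> C" using C[of 0] by simp
  ultimately show ?thesis
    unfolding integrable_pmf_count_space
    by (elim Bochner_Integration.integrable_bound) (auto simp: AE_count_space abs_mult)
qed

lemma integrable_le_square_total:
  fixes f :: "system \<Rightarrow> real"
  assumes "\<And>x. \<bar>f x\<bar> \<le> (real (total x) + 1)\<^sup>2"
  shows "integrable S f"
  using assms by (intro Bochner_Integration.integrable_bound[OF integrable_square_total]) auto

definition generator :: "(system \<Rightarrow> real) \<Rightarrow> queue \<Rightarrow> system \<Rightarrow> real" where
  "generator f i x = rate i * (f (step (Arrive i) x) - f x)
     + rate (other i) * (f (step (Arrive (other i)) x) - f x)
     + (if 0 < snd x (fst x) then mu * (f (step Complete x) - f x) else 0)"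

text \<open>By invariance \<open>f\<close> and its one-step mean \<open>h\<close> have the same
  expectation, and the generator is \<open>(lam + mu) * (h - f)\<close>. Comparing nonnegative
  integrals first also yields integrability of \<open>h\<close>; the quadratic bound makes them
  finite.\<close>

lemma integral_generator_eq_0:
  fixes f :: "system \<Rightarrow> real"
  assumes f_0: "\<And>x. 0 \<le> f x" and f: "\<And>x. f x \<le> (real (total x) + 1)\<^sup>2"
  shows "(\<integral>x. generator f i x \<partial>S) = 0"
proof -
  define h where "h x = (\<integral>e. f (uniformized_step e x) \<partial>E)" for x
  have h_0: "0 \<le> h x" for x unfolding h_def by (intro integral_nonneg_AE) (auto simp: f_0)
  have f_int: "integrable S f"
    using f f_0 by (intro integrable_le_square_total) auto
  have fin: "finite (set_pmf E)"
    by (rule finite_subset[OF subset_UNIV]) (simp add: UNIV_event)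
  have "(\<integral>\<^sup>+x. ennreal (f x) \<partial>S) = (\<integral>\<^sup>+x. (\<integral>\<^sup>+e. ennreal (f (uniformized_step e x)) \<partial>E) \<partial>S)"
    by (subst steady_state_invariant[symmetric]) (simp add: kernel_def)
  also have "\<dots> = (\<integral>\<^sup>+x. ennreal (h x) \<partial>S)"
    unfolding h_def
    by (intro nn_integral_cong nn_integral_eq_integral integrable_measure_pmf_finite fin) (simp add: f_0)
  finally have eq: "(\<integral>\<^sup>+x. ennreal (f x) \<partial>S) = (\<integral>\<^sup>+x. ennreal (h x) \<partial>S)" .
  moreover have "(\<integral>\<^sup>+x. ennreal (f x) \<partial>S) < \<infinity>"
    using nn_integral_eq_integral[OF f_int] f_0 by simp
  ultimately have h_int: "integrable S h"
    using h_0 by (intro integrableI_nonneg) auto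
  have "(\<integral>x. f x \<partial>S) = (\<integral>x. h x \<partial>S)"
    using eq f_0 h_0 by (simp add: integral_eq_nn_integral)
  then have "(\<integral>x. (lam + mu) * (h x - f x) \<partial>S) = 0"
    using f_int h_int by simp
  moreover have "(lam + mu) * (h x - f x) = generator f i x" for x
  proof -
    have "(lam + mu) * h x = rate i * f (step (Arrive i) x) + rate (other i) * f (step (Arrive (other i)) x)
        + mu * f (uniformized_step Complete x)"
      using lam mu unfolding h_def integral_event[where i=i] by (simp add: uniformized_step_def)
    moreover have "(lam + mu) * f x = rate i * f x + rate (other i) * f x + mu * f x"
      unfolding rate_other by (simp add: algebra_simps)
    ultimately show ?thesis
      unfolding generator_def right_diff_distrib by (simp add: uniformized_step_def)
  qed
  ultimately show ?thesis by simp
qed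

lemma integral_steady_state_cong:
  "(\<And>x. settled x \<Longrightarrow> f x = g x) \<Longrightarrow> (\<integral>x. f x \<partial>S) = (\<integral>x. g x \<partial>S)" for f g :: "system \<Rightarrow> real"
  by (intro integral_cong_AE) (auto simp: AE_measure_pmf_iff dest: steady_state_settled)

text \<open>\<open>mean_busy i\<close> and \<open>mean_idle i\<close> are the unknowns
  \<open>a\<^sub>i\<close> and \<open>b\<^sub>i\<close> of the linear system.\<close>

definition mean_busy :: "queue \<Rightarrow> real" where
  "mean_busy i = (\<integral>x. of_bool (fst x = i) * real (snd x i) \<partial>S)"

definition mean_idle :: "queue \<Rightarrow> real" where
  "mean_idle i = (\<integral>x. of_bool (fst x \<noteq> i) * real (snd x i) \<partial>S)"

lemma le_square: "k \<le> n \<Longrightarrow> real k \<le> (real n + 1)\<^sup>2"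
proof -
  assume "k \<le> n"
  then have "real k \<le> real n + 1" by simp
  also have "\<dots> \<le> (real n + 1)\<^sup>2" by (simp add: power2_eq_square)
  finally show ?thesis .
qed

lemma product_le_square: "k \<le> n \<Longrightarrow> m \<le> n \<Longrightarrow> real k * real m \<le> (real n + 1)\<^sup>2"
  unfolding power2_eq_square by (intro mult_mono) auto

lemma queue_le_total: "snd x i \<le> total x"
  using total_eq[of x i] by simp

lemma
  shows integrable_busy: "integrable S (\<lambda>x. of_bool (fst x = i) * real (snd x j))"
    and integrable_idle: "integrable S (\<lambda>x. of_bool (fst x \<noteq> i) * real (snd x j))"
    and integrable_queue: "integrable S (\<lambda>x. real (snd x j))"
  using le_square[OF queue_le_total] by (auto intro!: integrable_le_square_total)

lemma mean_queue: "(\<integral>x. real (snd x i) \<partial>S) = mean_busy i + mean_idle i"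
  unfolding mean_busy_def mean_idle_def
  by (subst Bochner_Integration.integral_add[OF integrable_busy integrable_idle, symmetric])
    (auto intro!: Bochner_Integration.integral_cong)

text \<open>Flow balance: the generator applied to the length of queue \<open>i\<close> gives its
  arrival rate minus its departure rate.\<close>

lemma prob_serving: "(\<integral>x. of_bool (fst x = i \<and> 0 < snd x i) \<partial>S) = rate i / mu"
proof -
  have int: "integrable S (\<lambda>x. of_bool (fst x = i \<and> 0 < snd x i) :: real)"
    by (rule measure_pmf.integrable_const_bound[where B=1]) auto
  have "0 = (\<integral>x. generator (\<lambda>x. real (snd x i)) i x \<partial>S)"
    by (rule integral_generator_eq_0[symmetric]) (auto intro: le_square queue_le_total)
  also have "\<dots> = (\<integral>x. rate i - mu * of_bool (fst x = i \<and> 0 < snd x i) \<partial>S)"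
  proof (rule integral_steady_state_cong)
    fix x assume "settled x"
    obtain s n where x: "x = (s, n)" by (cases x)
    show "generator (\<lambda>x. real (snd x i)) i x = rate i - mu * of_bool (fst x = i \<and> 0 < snd x i)"
      by (cases "s = i") (auto simp: generator_def x of_nat_diff algebra_simps)
  qed
  also have "\<dots> = rate i - mu * (\<integral>x. of_bool (fst x = i \<and> 0 < snd x i) \<partial>S)"
    using int by simp
  finally show ?thesis using mu by (simp add: field_simps)
qed

lemma mean_busy_eq: "mu * mean_busy i = rate i * (mean_busy i + mean_idle i + 1)"
proof -
  have int: "integrable S (\<lambda>x. of_bool (fst x = i \<and> 0 < snd x i) :: real)"
    by (rule measure_pmf.integrable_const_bound[where B=1]) auto
  have "0 = (\<integral>x. generator (\<lambda>x. (real (snd x i))\<^sup>2) i x \<partial>S)"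
    by (rule integral_generator_eq_0[symmetric])
      (auto simp: power2_eq_square[of "real (snd _ _)"] intro: product_le_square queue_le_total)
  also have "\<dots> = (\<integral>x. rate i * (2 * real (snd x i) + 1)
      + mu * of_bool (fst x = i \<and> 0 < snd x i) - 2 * mu * (of_bool (fst x = i) * real (snd x i)) \<partial>S)"
  proof (rule integral_steady_state_cong)
    fix x assume "settled x"
    obtain s n where x: "x = (s, n)" by (cases x)
    show "generator (\<lambda>x. (real (snd x i))\<^sup>2) i x = rate i * (2 * real (snd x i) + 1)
      + mu * of_bool (fst x = i \<and> 0 < snd x i) - 2 * mu * (of_bool (fst x = i) * real (snd x i))"
      by (cases "s = i"; cases "n i") (auto simp: generator_def x algebra_simps power2_eq_square)
  qed
  also have "\<dots> = rate i * (2 * (\<integral>x. real (snd x i) \<partial>S) + 1)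
      + mu * (\<integral>x. of_bool (fst x = i \<and> 0 < snd x i) \<partial>S) - 2 * mu * mean_busy i"
    unfolding mean_busy_def using int integrable_queue[of i] integrable_busy[of i i] by simp
  finally show ?thesis
    using mu unfolding prob_serving mean_queue by (simp add: algebra_simps)
qed

lemma mean_idle_eq: "(mu - rate (other i)) * mean_idle i = rate i * mean_busy (other i)"
proof -
  let ?f = "\<lambda>x. of_bool (fst x \<noteq> i) * (real (snd x i) * real (snd x (other i)))"
  have "?f x \<le> (real (total x) + 1)\<^sup>2" for x
    using product_le_square[OF queue_le_total queue_le_total] by auto
  then have "0 = (\<integral>x. generator ?f i x \<partial>S)"
    by (intro integral_generator_eq_0[symmetric]) auto
  also have "\<dots> = (\<integral>x. rate i * (of_bool (fst x = other i) * real (snd x (other i)))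
      - (mu - rate (other i)) * (of_bool (fst x \<noteq> i) * real (snd x i)) \<partial>S)"
  \<comment> \<open>While the server is at \<open>i\<close> the function is 0, and it stays 0
    because the server leaves only once queue \<open>i\<close> is empty. While it is at the other
    queue, a completion there lowers the function by the length of queue \<open>i\<close>; this
    includes the last completion, which moves the server to \<open>i\<close> and sets the function
    to 0.\<close>
  proof (rule integral_steady_state_cong)
    fix x assume s: "settled x"
    obtain s n where x: "x = (s, n)" by (cases x)
    show "generator ?f i x = rate i * (of_bool (fst x = other i) * real (snd x (other i)))
      - (mu - rate (other i)) * (of_bool (fst x \<noteq> i) * real (snd x i))"
    proof (cases "s = i")
      case True
      then show ?thesis using s
        by (cases "n i"; cases "n (other i)") (auto simp: generator_def x settled_def)
    next
      case False
      then have "s = other i" by (simp add: eq_other_iff)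
      then show ?thesis using s
        by (cases "n i"; cases "n (other i)") (auto simp: generator_def x settled_def algebra_simps)
    qed
  qed
  also have "\<dots> = rate i * mean_busy (other i) - (mu - rate (other i)) * mean_idle i"
    unfolding mean_busy_def mean_idle_def using integrable_busy integrable_idle by simp
  finally show ?thesis by simp
qed

end

text \<open>Eliminating \<open>a1\<close> and \<open>a2\<close> leaves two equations for
  \<open>b1\<close> and \<open>b2\<close> with determinant
  \<open>(A * B)\<^sup>2 - P\<^sup>2\<close>, which factors into \<open>A * B - P\<close> and
  \<open>A * B + P\<close>. The first factor is \<open>mu * (mu - (r1 + r2))\<close>, positive by
  stability. The first conclusion is the mean of an M/M/1 queue.\<close>

lemma two_queue_moments:
  fixes mu r1 r2 a1 a2 b1 b2 :: real
  assumes r: "0 \<le> r1" "0 \<le> r2" "r1 + r2 < mu"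
    and a1: "mu * a1 = r1 * (a1 + b1 + 1)" and a2: "mu * a2 = r2 * (a2 + b2 + 1)"
    and b1: "(mu - r2) * b1 = r1 * a2" and b2: "(mu - r1) * b2 = r2 * a1"
  shows "a1 + a2 + b1 + b2 = (r1 + r2) / (mu - (r1 + r2))"
    and "b1 + b2 = r1 * r2 * (mu\<^sup>2 + (mu - (r1 + r2))\<^sup>2)
      / (mu * (mu - (r1 + r2)) * (mu * (mu - (r1 + r2)) + 2 * (r1 * r2)))"
proof -
  define A B P where "A = mu - r1" and "B = mu - r2" and "P = r1 * r2"
  have pos: "0 < A" "0 < B" "0 \<le> P" "0 < mu" using r by (auto simp: A_def B_def P_def)
  have AB: "A * B - P = mu * (mu - (r1 + r2))" by (simp add: A_def B_def P_def algebra_simps)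
  have ABP: "A * B + P = mu * (mu - (r1 + r2)) + 2 * P" using AB by simp
  have gap: "0 < mu - (r1 + r2)" using r by simp
  then have "0 < mu * (mu - (r1 + r2))" using pos by simp
  then have AB0: "A * B - P \<noteq> 0" "A * B + P \<noteq> 0"
    using AB ABP pos by linarith+
  have a1': "A * a1 = r1 * (1 + b1)" and a2': "B * a2 = r2 * (1 + b2)"
    using a1 a2 by (simp_all add: A_def B_def algebra_simps)
  have "B\<^sup>2 * b1 = P * (1 + b2)" "A\<^sup>2 * b2 = P * (1 + b1)"
    using a1' a2' b1 b2 unfolding A_def[symmetric] B_def[symmetric] P_def by algebra+
  then have b1': "(A * B - P) * (A * B + P) * b1 = P * (A\<^sup>2 + P)"
    and b2': "(A * B - P) * (A * B + P) * b2 = P * (B\<^sup>2 + P)" by algebra+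
  show "b1 + b2 = r1 * r2 * (mu\<^sup>2 + (mu - (r1 + r2))\<^sup>2)
      / (mu * (mu - (r1 + r2)) * (mu * (mu - (r1 + r2)) + 2 * (r1 * r2)))"
  proof -
    have "(A * B - P) * (A * B + P) * (b1 + b2) = P * (A\<^sup>2 + B\<^sup>2 + 2 * P)"
      using b1' b2' by algebra
    \<comment> \<open>The numerator depends on the total rate only, so for fixed total rate the
      routing enters through \<open>P\<close> alone.\<close>
    also have "A\<^sup>2 + B\<^sup>2 + 2 * P = mu\<^sup>2 + (mu - (r1 + r2))\<^sup>2"
      unfolding A_def B_def P_def by algebra
    finally show ?thesis
      using AB0 unfolding P_def[symmetric] unfolding ABP[symmetric] unfolding AB[symmetric]
      by (subst nonzero_eq_divide_eq) (simp, simp only: mult_ac)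
  qed
  \<comment> \<open>The extra factor \<open>A\<close> allows substituting \<open>A * a1\<close>; it
    is positive and cancels.\<close>
  have "A * ((A * B - P) * (A * B + P) * a1) = A * (r1 * A * (B\<^sup>2 + P))"
    using a1' b1' by algebra
  then have a1'': "(A * B - P) * (A * B + P) * a1 = r1 * A * (B\<^sup>2 + P)" using pos by simp
  have "B * ((A * B - P) * (A * B + P) * a2) = B * (r2 * B * (A\<^sup>2 + P))"
    using a2' b2' by algebra
  then have a2'': "(A * B - P) * (A * B + P) * a2 = r2 * B * (A\<^sup>2 + P)" using pos by simp
  have "(A * B - P) * (A * B + P) * (a1 + a2 + b1 + b2)
      = r1 * A * (B\<^sup>2 + P) + r2 * B * (A\<^sup>2 + P) + P * (A\<^sup>2 + P) + P * (B\<^sup>2 + P)"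
    using a1'' a2'' b1' b2' by algebra
  also have "\<dots> = mu * (A * B + P) * (r1 + r2)"
    unfolding A_def B_def P_def by algebra
  finally have "mu * (A * B + P) * ((mu - (r1 + r2)) * (a1 + a2 + b1 + b2)) = mu * (A * B + P) * (r1 + r2)"
    unfolding AB by (simp only: mult_ac)
  then have "(mu - (r1 + r2)) * (a1 + a2 + b1 + b2) = r1 + r2" using AB0 pos by simp
  then show "a1 + a2 + b1 + b2 = (r1 + r2) / (mu - (r1 + r2))"
    using gap by (simp add: field_simps)
qed

section \<open>The expected cost of a tagged customer\<close>

lemma nn_integral_exponential_density:
  assumes "0 < l"
  shows "(\<integral>\<^sup>+x. ennreal (exponential_density l x) \<partial>lborel) = 1"
proof -
  interpret prob_space "density lborel (exponential_density l)"
    by (rule prob_space_exponential_density[OF assms])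
  show ?thesis using emeasure_space_1 by (simp add: emeasure_density)
qed

lemma emeasure_exponential_tail:
  assumes l: "0 < l" and a: "0 \<le> a"
  shows "emeasure (density lborel (exponential_density l)) {a<..} = ennreal (exp (- a * l))"
    and "emeasure (density lborel (exponential_density l)) {a..} = ennreal (exp (- a * l))"
proof -
  interpret prob_space "density lborel (exponential_density l)"
    by (rule prob_space_exponential_density[OF l])
  have "distributed (density lborel (exponential_density l)) lborel (\<lambda>x. x) (exponential_density l)"
    by (auto simp: distributed_def distr_id2)
  from exponential_distributedD_gt[OF this a l]
  show "emeasure (density lborel (exponential_density l)) {a<..} = ennreal (exp (- a * l))"
    by (simp add: emeasure_eq_measure greaterThan_def)
  also have "emeasure (density lborel (exponential_density l)) {a<..}
      = emeasure (density lborel (exponential_density l)) {a..}"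
  proof (rule emeasure_eq_AE)
    show "AE x in density lborel (exponential_density l). (x \<in> {a<..}) = (x \<in> {a..})"
      using AE_lborel_singleton[of a] by (subst AE_density) (auto elim!: eventually_mono)
  qed auto
  finally show "emeasure (density lborel (exponential_density l)) {a..} = ennreal (exp (- a * l))" .
qed

text \<open>Exponential tilting: the integrand is \<open>l / (l + m)\<close> times the exponential
  density of rate \<open>l + m\<close>.\<close>

lemma nn_integral_exponential_exp:
  assumes l: "0 < l" and m: "0 < m"
  shows "(\<integral>\<^sup>+x. ennreal (exp (- x * m)) \<partial>density lborel (exponential_density l)) = ennreal (l / (l + m))"
proof -
  have "(\<integral>\<^sup>+x. ennreal (exp (- x * m)) \<partial>density lborel (exponential_density l))
      = (\<integral>\<^sup>+x. ennreal (exponential_density l x) * ennreal (exp (- x * m)) \<partial>lborel)"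
    by (rule nn_integral_density) auto
  also have "\<dots> = (\<integral>\<^sup>+x. ennreal (l / (l + m)) * ennreal (exponential_density (l + m) x) \<partial>lborel)"
  proof (rule nn_integral_cong)
    fix x
    have "exponential_density l x * exp (- x * m) = l / (l + m) * exponential_density (l + m) x"
    proof (cases "x < 0")
      case False
      have "exp (- x * (l + m)) = exp (- x * l) * exp (- x * m)"
        by (simp add: exp_add[symmetric] algebra_simps)
      moreover have "l / (l + m) * ((l + m) * z) = l * z" for z using l m by simp
      ultimately show ?thesis
        using False l m by (simp add: exponential_density_def ac_simps)
    qed (simp add: exponential_density_def)
    then show "ennreal (exponential_density l x) * ennreal (exp (- x * m))
        = ennreal (l / (l + m)) * ennreal (exponential_density (l + m) x)"
      using l m by (simp add: ennreal_mult'[symmetric] ennreal_mult''[symmetric] exponential_density_def)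
  qed
  also have "\<dots> = ennreal (l / (l + m))"
    using l m by (subst nn_integral_cmult) (auto simp: nn_integral_exponential_density)
  finally show ?thesis .
qed

section \<open>The law of the next event and the mean time until it\<close>

context polling
begin

abbreviation "ExpArr \<equiv> density lborel (exponential_density lam)"
abbreviation "ExpSrv \<equiv> density lborel (exponential_density mu)"
abbreviation "Route \<equiv> measure_pmf (map_pmf (\<lambda>b. if b then Q1 else Q2) (bernoulli_pmf p))"
abbreviation "D \<equiv> draw_measure lam mu p"

lemma prob_space_draw: "prob_space D"
  unfolding draw_measure_def
  using lam mu by (intro prob_space_pair prob_space_exponential_density prob_space_measure_pmf)

lemma sets_draw [measurable_cong]: "sets D = sets (borel \<Otimes>\<^sub>M (borel \<Otimes>\<^sub>M count_space UNIV))"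
  unfolding draw_measure_def by (intro sets_pair_measure_cong) auto

lemma measurable_next_event [measurable]: "next_event x \<in> measurable D (count_space UNIV)"
proof -
  obtain s n where x: "x = (s, n)" by (cases x)
  have "next_event x = (\<lambda>w. if 0 < n s \<and> fst (snd w) < fst w then Complete else Arrive (snd (snd w)))"
    by (auto simp: x fun_eq_iff)
  then show ?thesis by simp
qed

lemma measurable_holding_time [measurable]: "holding_time x \<in> borel_measurable D"
proof -
  obtain s n where x: "x = (s, n)" by (cases x)
  have "holding_time x = (\<lambda>w. if 0 < n s then min (fst w) (fst (snd w)) else fst w)"
    by (auto simp: x fun_eq_iff)
  then show ?thesis by simp
qed

lemma nn_integral_event_pmf:
  "(\<integral>\<^sup>+e. F e \<partial>E) = ennreal (lam / (lam + mu)) * (\<integral>\<^sup>+q. F (Arrive q) \<partial>Route) + ennreal (mu / (lam + mu)) * F Complete"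
proof -
  have "1 - lam / (lam + mu) = mu / (lam + mu)" using lam mu by (simp add: field_simps)
  then show ?thesis using lam mu by (simp add: event_pmf_def mult.commute)
qed

lemma nn_integral_draw:
  assumes [measurable]: "f \<in> borel_measurable D"
  shows "(\<integral>\<^sup>+w. f w \<partial>D) = (\<integral>\<^sup>+u. \<integral>\<^sup>+v. \<integral>\<^sup>+q. f (u, v, q) \<partial>Route \<partial>ExpSrv \<partial>ExpArr)"
proof -
  interpret S: prob_space ExpSrv by (rule prob_space_exponential_density[OF mu])
  interpret SR: prob_space "ExpSrv \<Otimes>\<^sub>M Route" by (intro prob_space_pair S.prob_space_axioms prob_space_measure_pmf)
  have [measurable]: "f \<in> borel_measurable (ExpArr \<Otimes>\<^sub>M (ExpSrv \<Otimes>\<^sub>M Route))"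
    using assms by (simp add: draw_measure_def)
  have "(\<integral>\<^sup>+w. f w \<partial>D) = (\<integral>\<^sup>+u. \<integral>\<^sup>+vq. f (u, vq) \<partial>(ExpSrv \<Otimes>\<^sub>M Route) \<partial>ExpArr)"
    unfolding draw_measure_def by (rule SR.nn_integral_fst[symmetric]) measurable
  also have "\<dots> = (\<integral>\<^sup>+u. \<integral>\<^sup>+v. \<integral>\<^sup>+q. f (u, v, q) \<partial>Route \<partial>ExpSrv \<partial>ExpArr)"
    by (intro nn_integral_cong measure_pmf.nn_integral_fst[symmetric]) measurable
  finally show ?thesis .
qed

text \<open>Competing exponential clocks. The second integral conditions on the arrival time
  directly; the first one is exchanged so as to condition on the service time. Ties count as
  arrivals, in agreement with the strict \<open>v < u\<close> in \<open>next_event\<close>.\<close>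

lemma service_before_arrival:
  "(\<integral>\<^sup>+u. emeasure ExpSrv {..<u} \<partial>ExpArr) = ennreal (mu / (lam + mu))"
  "(\<integral>\<^sup>+u. emeasure ExpSrv {u..} \<partial>ExpArr) = ennreal (lam / (lam + mu))"
proof -
  interpret A: prob_space ExpArr by (rule prob_space_exponential_density[OF lam])
  interpret S: prob_space ExpSrv by (rule prob_space_exponential_density[OF mu])
  interpret AS: pair_sigma_finite ExpArr ExpSrv ..
  have nonneg: "AE x in density lborel (exponential_density l). P x" if "\<And>x. 0 \<le> x \<Longrightarrow> P x" for l P
    using that by (subst AE_density) (auto simp: exponential_density_def)
  have "(\<integral>\<^sup>+u. emeasure ExpSrv {u..} \<partial>ExpArr) = (\<integral>\<^sup>+u. ennreal (exp (- u * mu)) \<partial>ExpArr)"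
    by (intro nn_integral_cong_AE nonneg) (rule emeasure_exponential_tail[OF mu])
  then show "(\<integral>\<^sup>+u. emeasure ExpSrv {u..} \<partial>ExpArr) = ennreal (lam / (lam + mu))"
    using nn_integral_exponential_exp[OF lam mu] by simp
  have "(\<integral>\<^sup>+u. emeasure ExpSrv {..<u} \<partial>ExpArr) = (\<integral>\<^sup>+u. \<integral>\<^sup>+v. indicator {v<..} u \<partial>ExpSrv \<partial>ExpArr)"
  proof (rule nn_integral_cong)
    fix u
    have "(\<integral>\<^sup>+v. indicator {v<..} u \<partial>ExpSrv) = (\<integral>\<^sup>+v. indicator {..<u} v \<partial>ExpSrv)"
      by (intro nn_integral_cong) (simp add: indicator_def)
    then show "emeasure ExpSrv {..<u} = (\<integral>\<^sup>+v. indicator {v<..} u \<partial>ExpSrv)" by simp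
  qed
  also have "\<dots> = (\<integral>\<^sup>+v. \<integral>\<^sup>+u. indicator {v<..} u \<partial>ExpArr \<partial>ExpSrv)"
    by (rule AS.Fubini'[symmetric]) (simp add: indicator_def)
  also have "\<dots> = (\<integral>\<^sup>+v. ennreal (exp (- v * lam)) \<partial>ExpSrv)"
    by (intro nn_integral_cong_AE nonneg) (simp add: emeasure_exponential_tail lam)
  finally show "(\<integral>\<^sup>+u. emeasure ExpSrv {..<u} \<partial>ExpArr) = ennreal (mu / (lam + mu))"
    using nn_integral_exponential_exp[OF mu lam] by (simp add: add.commute)
qed

text \<open>As long as somebody is in service, the simulated jump chain has the transition law of
  the uniformized chain, without fictitious events.\<close>

lemma nn_integral_next_event:
  assumes "0 < snd x (fst x)"
  shows "(\<integral>\<^sup>+w. F (next_event x w) \<partial>D) = (\<integral>\<^sup>+e. F e \<partial>E)"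
proof -
  interpret S: prob_space ExpSrv by (rule prob_space_exponential_density[OF mu])
  obtain s n where x: "x = (s, n)" by (cases x)
  have ns: "0 < n s" using assms by (simp add: x)
  let ?X = "\<integral>\<^sup>+q. F (Arrive q) \<partial>Route"
  have "(\<integral>\<^sup>+w. F (next_event x w) \<partial>D) = (\<integral>\<^sup>+u. \<integral>\<^sup>+v. \<integral>\<^sup>+q. F (next_event x (u, v, q)) \<partial>Route \<partial>ExpSrv \<partial>ExpArr)"
    by (rule nn_integral_draw) (rule measurable_compose[OF measurable_next_event], simp)
  also have "\<dots> = (\<integral>\<^sup>+u. \<integral>\<^sup>+v. F Complete * indicator {..<u} v + ?X * indicator {u..} v \<partial>ExpSrv \<partial>ExpArr)"
    using ns by (intro nn_integral_cong) (auto simp: x indicator_def)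
  also have "\<dots> = (\<integral>\<^sup>+u. F Complete * emeasure ExpSrv {..<u} + ?X * emeasure ExpSrv {u..} \<partial>ExpArr)"
    by (intro nn_integral_cong) (simp add: nn_integral_add nn_integral_cmult)
  also have "\<dots> = F Complete * ennreal (mu / (lam + mu)) + ?X * ennreal (lam / (lam + mu))"
    unfolding service_before_arrival[symmetric]
  proof (subst nn_integral_add)
    have [measurable]: "(\<lambda>u. emeasure ExpSrv {..<u}) \<in> borel_measurable borel"
      "(\<lambda>u. emeasure ExpSrv {u..}) \<in> borel_measurable borel"
    proof -
      have sets: "sets (borel \<Otimes>\<^sub>M ExpSrv) = sets (borel \<Otimes>\<^sub>M (borel :: real measure))"
        by (intro sets_pair_measure_cong) auto
      have "{w \<in> space (borel \<Otimes>\<^sub>M borel). snd w < (fst w :: real)} \<in> sets (borel \<Otimes>\<^sub>M borel)"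
        "{w \<in> space (borel \<Otimes>\<^sub>M borel). fst w \<le> (snd w :: real)} \<in> sets (borel \<Otimes>\<^sub>M borel)"
        by measurable
      then have "(\<lambda>u. emeasure ExpSrv (Pair u -` {w. snd w < fst w})) \<in> borel_measurable borel"
        "(\<lambda>u. emeasure ExpSrv (Pair u -` {w. fst w \<le> snd w})) \<in> borel_measurable borel"
        by (auto intro!: S.measurable_emeasure_Pair simp: sets space_pair_measure)
      then show "(\<lambda>u. emeasure ExpSrv {..<u}) \<in> borel_measurable borel"
        "(\<lambda>u. emeasure ExpSrv {u..}) \<in> borel_measurable borel"
        by (simp_all add: vimage_def lessThan_def atLeast_def)
    qed
    show "(\<lambda>u. F Complete * emeasure ExpSrv {..<u}) \<in> borel_measurable ExpArr"
      "(\<lambda>u. ?X * emeasure ExpSrv {u..}) \<in> borel_measurable ExpArr" by simp_all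
    show "(\<integral>\<^sup>+u. F Complete * emeasure ExpSrv {..<u} \<partial>ExpArr) + (\<integral>\<^sup>+u. ?X * emeasure ExpSrv {u..} \<partial>ExpArr)
      = F Complete * (\<integral>\<^sup>+u. emeasure ExpSrv {..<u} \<partial>ExpArr) + ?X * (\<integral>\<^sup>+u. emeasure ExpSrv {u..} \<partial>ExpArr)"
      by (simp add: nn_integral_cmult)
  qed
  finally show ?thesis unfolding nn_integral_event_pmf by (simp add: ac_simps)
qed

text \<open>The minimum of two numbers is the length of the time interval that precedes both.\<close>

lemma nn_integral_holding_time:
  assumes "0 < snd x (fst x)"
  shows "(\<integral>\<^sup>+w. ennreal (holding_time x w) \<partial>D) = ennreal (1 / (lam + mu))"
proof -
  interpret A: prob_space ExpArr by (rule prob_space_exponential_density[OF lam])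
  interpret S: prob_space ExpSrv by (rule prob_space_exponential_density[OF mu])
  interpret SR: prob_space "ExpSrv \<Otimes>\<^sub>M Route" by (intro prob_space_pair S.prob_space_axioms prob_space_measure_pmf)
  interpret D: prob_space D by (rule prob_space_draw)
  interpret DL: pair_sigma_finite D lborel ..
  let ?I = "\<lambda>w t. if 0 \<le> t \<and> t < fst w \<and> t < fst (snd w) then 1 else 0 :: ennreal"
  have "(\<integral>\<^sup>+w. ennreal (holding_time x w) \<partial>D) = (\<integral>\<^sup>+w. \<integral>\<^sup>+t. ?I w t \<partial>lborel \<partial>D)"
  proof (rule nn_integral_cong)
    fix w :: draw
    obtain s n u v q where x: "x = (s, n)" and w: "w = (u, v, q)" by (metis prod_cases3 surj_pair)
    have "(\<integral>\<^sup>+t. ?I w t \<partial>lborel) = (\<integral>\<^sup>+t. indicator {0..<min u v} t \<partial>lborel)"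
      by (intro nn_integral_cong) (auto simp: w)
    also have "\<dots> = ennreal (min u v)"
      by (cases "0 \<le> min u v") (auto simp: ennreal_neg)
    finally show "ennreal (holding_time x w) = (\<integral>\<^sup>+t. ?I w t \<partial>lborel)"
      using assms by (simp add: x w)
  qed
  also have "\<dots> = (\<integral>\<^sup>+t. \<integral>\<^sup>+w. ?I w t \<partial>D \<partial>lborel)"
    by (rule DL.Fubini'[symmetric]) measurable
  \<comment> \<open>The inner integral is the probability that both clocks exceed \<open>t\<close>.
    Written as a multiple of a density, it integrates at once.\<close>
  also have "\<dots> = (\<integral>\<^sup>+t. ennreal (1 / (lam + mu)) * ennreal (exponential_density (lam + mu) t) \<partial>lborel)"
  proof (rule nn_integral_cong)
    fix t :: real
    show "(\<integral>\<^sup>+w. ?I w t \<partial>D) = ennreal (1 / (lam + mu)) * ennreal (exponential_density (lam + mu) t)"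
    proof (cases "0 \<le> t")
      case True
      have "(\<integral>\<^sup>+w. ?I w t \<partial>D) = (\<integral>\<^sup>+w. indicator ({t<..} \<times> {t<..} \<times> UNIV) w \<partial>D)"
        using True by (intro nn_integral_cong) (auto simp: indicator_def)
      also have "\<dots> = emeasure D ({t<..} \<times> {t<..} \<times> UNIV)"
        by (rule nn_integral_indicator) (simp add: sets_draw)
      also have "\<dots> = ennreal (exp (- t * lam)) * ennreal (exp (- t * mu))"
        unfolding draw_measure_def
        by (simp add: SR.emeasure_pair_measure_Times measure_pmf.emeasure_pair_measure_Times
            emeasure_exponential_tail lam mu True)
      also have "\<dots> = ennreal (1 / (lam + mu)) * ennreal (exponential_density (lam + mu) t)"
      proof -
        have "exp (- t * lam) * exp (- t * mu) = 1 / (lam + mu) * exponential_density (lam + mu) t"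
        proof -
          have "exp (- t * lam) * exp (- t * mu) = exp (- t * (lam + mu))"
            by (simp add: exp_add[symmetric] algebra_simps)
          then show ?thesis using lam mu True by (simp add: exponential_density_def ac_simps)
        qed
        then show ?thesis
          using lam mu True by (simp add: ennreal_mult[symmetric] exponential_density_def)
      qed
      finally show ?thesis .
    qed (auto simp: exponential_density_def)
  qed
  also have "\<dots> = ennreal (1 / (lam + mu))"
    using lam mu by (subst nn_integral_cmult) (auto simp: nn_integral_exponential_density)
  finally show ?thesis .
qed

end

section \<open>First-step analysis of the tagged customer\<close>

lemma trajectory_Stream:
  "trajectory i z (w ## ws) (Suc k) = trajectory i (tagged_step i (next_event (fst z) w) z) ws k"
  by (induction k) simp_all

lemma trajectory_left: "snd z = None \<Longrightarrow> snd (trajectory i z w k) = None"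
  by (induction k) (simp_all, metis (no_types, lifting) option.simps(4) prod.collapse snd_conv tagged_step.simps)

context polling
begin

text \<open>The invariant of the tagged chain until she leaves. A service is always in progress, so
  the laws of the next event and of the holding time apply at every stage.\<close>

definition waiting :: "queue \<Rightarrow> tagged \<Rightarrow> bool" where
  "waiting i z \<longleftrightarrow> (\<exists>k. snd z = Some k \<and> 0 < snd (fst z) (fst (fst z)) \<and> k < snd (fst z) i)"

lemma waiting_cases:
  assumes "waiting i z"
  obtains
    (served) n k where "z = ((i, n), Some k)" "k < n i"
  | (delayed) n k where "z = ((other i, n), Some k)" "k < n i" "0 < n (other i)"
  using assms unfolding waiting_def
  by (cases z; cases "fst (fst z) = i") (auto simp: eq_other_iff[symmetric])

lemma tagged_step_served:
  assumes "k < n i"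
  shows "tagged_step i (Arrive q) ((i, n), Some k) = ((i, n(q := Suc (n q))), Some k)"
    and "0 < k \<Longrightarrow> tagged_step i Complete ((i, n), Some k) = ((i, n(i := n i - 1)), Some (k - 1))"
    and "k = 0 \<Longrightarrow> snd (tagged_step i Complete ((i, n), Some k)) = None"
  using assms by auto

text \<open>The tagged customer keeps queue \<open>i\<close> nonempty, so the server moves there
  exactly when the last customer of the other queue leaves.\<close>

lemma tagged_step_delayed:
  assumes "k < n i" "0 < n (other i)"
  shows "tagged_step i (Arrive q) ((other i, n), Some k) = ((other i, n(q := Suc (n q))), Some k)"
    and "tagged_step i Complete ((other i, n), Some k)
      = ((if n (other i) = 1 then i else other i, n(other i := n (other i) - 1)), Some k)"
  using assms by auto

lemma waiting_tagged_step:
  assumes "waiting i z"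
  shows "snd (tagged_step i e z) = None \<or> waiting i (tagged_step i e z)"
  using assms
proof (cases rule: waiting_cases)
  case (served n k)
  then show ?thesis
    by (cases e; cases "k = 0") (auto simp: waiting_def tagged_step_served simp del: tagged_step.simps)
next
  case (delayed n k)
  then show ?thesis
    by (cases e) (auto simp: waiting_def tagged_step_delayed simp del: tagged_step.simps)
qed

lemma measurable_trajectory [measurable]:
  "(\<lambda>w. trajectory i z w k) \<in> measurable (stream_space D) (count_space UNIV)"
proof (induction k)
  case (Suc k)
  have "(\<lambda>w. tagged_step i (next_event (fst y) (w !! k)) y) \<in> measurable (stream_space D) (count_space UNIV)" for y
    by (rule measurable_compose[OF measurable_compose[OF measurable_snth measurable_next_event]]) simp
  from measurable_compose_countable[OF this Suc] show ?case by simp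
qed simp

definition stage_cost :: "real \<Rightarrow> real \<Rightarrow> queue \<Rightarrow> tagged \<Rightarrow> draw stream \<Rightarrow> nat \<Rightarrow> ennreal" where
  "stage_cost c d i z w k = ennreal (cost_rate c d i (trajectory i z w k) *
     holding_time (fst (trajectory i z w k)) (w !! k))"

lemma measurable_stage_cost [measurable]: "(\<lambda>w. stage_cost c d i z w k) \<in> borel_measurable (stream_space D)"
proof -
  have "(\<lambda>w. ennreal (cost_rate c d i y * holding_time (fst y) (w !! k))) \<in> borel_measurable (stream_space D)" for y
    using measurable_compose[OF measurable_snth measurable_holding_time] by measurable
  from measurable_compose_countable[OF this measurable_trajectory] show ?thesis
    unfolding stage_cost_def .
qed

definition mean_stage_cost :: "real \<Rightarrow> real \<Rightarrow> queue \<Rightarrow> nat \<Rightarrow> tagged \<Rightarrow> ennreal" where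
  "mean_stage_cost c d i k z = (\<integral>\<^sup>+w. stage_cost c d i z w k \<partial>stream_space D)"

lemma mean_total_cost:
  "(\<integral>\<^sup>+w. total_cost c d i z w \<partial>stream_space D) = (\<Sum>k. mean_stage_cost c d i k z)"
  unfolding total_cost_def mean_stage_cost_def stage_cost_def[symmetric]
  by (rule nn_integral_suminf) measurable

lemma mean_stage_cost_left: "snd z = None \<Longrightarrow> mean_stage_cost c d i k z = 0"
proof -
  assume "snd z = None"
  then have "cost_rate c d i (trajectory i z w k) = 0" for w
    using trajectory_left[of z i w k] by (cases "trajectory i z w k"; cases "fst (trajectory i z w k)") auto
  then show ?thesis by (simp add: mean_stage_cost_def stage_cost_def)
qed

lemma mean_stage_cost_0:
  assumes "waiting i z" "0 \<le> c" "0 \<le> d"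
  shows "mean_stage_cost c d i 0 z = ennreal (cost_rate c d i z / (lam + mu))"
proof -
  interpret D: prob_space D by (rule prob_space_draw)
  interpret DS: prob_space "stream_space D" by (rule D.prob_space_stream_space)
  have c: "0 \<le> cost_rate c d i z"
    using assms by (cases rule: waiting_cases) auto
  have "mean_stage_cost c d i 0 z = (\<integral>\<^sup>+w. \<integral>\<^sup>+ws. stage_cost c d i z (w ## ws) 0 \<partial>stream_space D \<partial>D)"
    unfolding mean_stage_cost_def by (rule D.nn_integral_stream_space) measurable
  also have "\<dots> = (\<integral>\<^sup>+w. ennreal (cost_rate c d i z) * ennreal (holding_time (fst z) w) \<partial>D)"
    using c by (simp add: stage_cost_def ennreal_mult' DS.emeasure_space_1)
  also have "\<dots> = ennreal (cost_rate c d i z) * ennreal (1 / (lam + mu))"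
    using assms by (subst nn_integral_cmult) (auto simp: waiting_def nn_integral_holding_time)
  finally show ?thesis using c lam mu by (simp add: ennreal_mult[symmetric])
qed

text \<open>Markov property: splitting off the first draw leaves a fresh stream that is started from
  the state after the first event.\<close>

lemma mean_stage_cost_Suc:
  assumes "waiting i z"
  shows "mean_stage_cost c d i (Suc k) z = (\<integral>\<^sup>+e. mean_stage_cost c d i k (tagged_step i e z) \<partial>E)"
proof -
  interpret D: prob_space D by (rule prob_space_draw)
  have "mean_stage_cost c d i (Suc k) z
      = (\<integral>\<^sup>+w. \<integral>\<^sup>+ws. stage_cost c d i z (w ## ws) (Suc k) \<partial>stream_space D \<partial>D)"
    unfolding mean_stage_cost_def by (rule D.nn_integral_stream_space) measurable
  also have "\<dots> = (\<integral>\<^sup>+w. mean_stage_cost c d i k (tagged_step i (next_event (fst z) w) z) \<partial>D)"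
    unfolding mean_stage_cost_def stage_cost_def trajectory_Stream snth.simps stream.sel ..
  also have "\<dots> = (\<integral>\<^sup>+e. mean_stage_cost c d i k (tagged_step i e z) \<partial>E)"
    using assms by (intro nn_integral_next_event) (auto simp: waiting_def)
  finally show ?thesis .
qed

text \<open>The candidate for the expected remaining cost: \<open>k + 1\<close> services of mean
  \<open>1 / mu\<close> at rate \<open>c\<close>, preceded at rate \<open>d\<close> by the mean busy
  period that the customers of the other queue generate together with later arrivals there.\<close>

definition cost_to_go :: "real \<Rightarrow> real \<Rightarrow> queue \<Rightarrow> tagged \<Rightarrow> real" where
  "cost_to_go c d i z = (case snd z of None \<Rightarrow> 0 | Some k \<Rightarrow> c * (real k + 1) / mu
     + (if fst (fst z) = i then 0 else d * real (snd (fst z) (other i)) / (mu - rate (other i))))"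

text \<open>A function that dominates the cost to go and contracts along the chain of tagged states.\<close>

definition potential :: "real \<Rightarrow> queue \<Rightarrow> tagged \<Rightarrow> real" where
  "potential \<theta> i z = (case snd z of None \<Rightarrow> 0 | Some k \<Rightarrow>
     \<theta> ^ Suc k * (if fst (fst z) = i then 1 else \<theta> ^ snd (fst z) (other i)))"

lemma cost_to_go_nonneg: "0 \<le> c \<Longrightarrow> 0 \<le> d \<Longrightarrow> 0 \<le> cost_to_go c d i z"
  using mu rate_less[of "other i"]
  by (auto simp: cost_to_go_def intro!: add_nonneg_nonneg divide_nonneg_nonneg split: option.splits)

lemma potential_nonneg: "0 \<le> \<theta> \<Longrightarrow> 0 \<le> potential \<theta> i z"
  by (auto simp: potential_def split: option.splits)

lemma nn_integral_event:
  fixes f :: "event \<Rightarrow> real"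
  assumes "\<And>e. 0 \<le> f e"
  shows "(\<integral>\<^sup>+e. ennreal (f e) \<partial>E)
    = ennreal ((rate i * f (Arrive i) + rate (other i) * f (Arrive (other i)) + mu * f Complete) / (lam + mu))"
  unfolding integral_event[symmetric]
proof (rule nn_integral_eq_integral)
  have "finite (UNIV :: event set)" by (simp add: UNIV_event)
  then show "integrable E f"
    by (rule integrable_measure_pmf_finite[OF finite_subset[OF subset_UNIV]])
qed (use assms in auto)

text \<open>The first-step equation. During her queue's service only completions matter, and each
  saves \<open>c / mu\<close>. Before that, arrivals at the other queue add
  \<open>g = d / (mu - rate (other i))\<close> and completions remove \<open>g\<close>, a drift of
  \<open>-d\<close>. When the server switches, the delay term has already reached 0.\<close>

lemma cost_to_go_step:
  assumes "waiting i z" "0 \<le> c" "0 \<le> d"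
  shows "ennreal (cost_to_go c d i z) = ennreal (cost_rate c d i z / (lam + mu))
    + (\<integral>\<^sup>+e. ennreal (cost_to_go c d i (tagged_step i e z)) \<partial>E)"
proof -
  let ?h = "\<lambda>e. cost_to_go c d i (tagged_step i e z)"
  have gap: "0 < mu - rate (other i)" using rate_less[of "other i"] by simp
  have rates: "rate i = lam - rate (other i)" using rate_other[of i] by simp
  have "(lam + mu) * cost_to_go c d i z
    = cost_rate c d i z + (rate i * ?h (Arrive i) + rate (other i) * ?h (Arrive (other i)) + mu * ?h Complete)"
    using assms(1)
  proof (cases rule: waiting_cases)
    case (served n k)
    have "?h Complete = c * real k / mu"
      unfolding served(1) using served(2)
      by (cases "k = 0") (auto simp: cost_to_go_def tagged_step_served simp del: tagged_step.simps)
    then show ?thesis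
      using served mu unfolding rates
      by (simp add: cost_to_go_def tagged_step_served del: tagged_step.simps)
        (simp add: field_simps)
  next
    case (delayed n k)
    define m where "m = real (n (other i))"
    define g where "g = d / (mu - rate (other i))"
    have g: "g * (mu - rate (other i)) = d" using gap by (simp add: g_def)
    define y where "y = c * (real k + 1) / mu"
    have z: "cost_to_go c d i z = y + g * m" "?h (Arrive i) = y + g * m"
      "?h (Arrive (other i)) = y + g * (m + 1)" "?h Complete = y + g * (m - 1)" "cost_rate c d i z = d"
      using delayed
      by (auto simp: y_def cost_to_go_def tagged_step_delayed m_def g_def of_nat_diff simp del: tagged_step.simps)
    show ?thesis unfolding z unfolding rates g[symmetric] by (simp add: algebra_simps)
  qed
  then have "cost_to_go c d i z = cost_rate c d i z / (lam + mu)
      + (rate i * ?h (Arrive i) + rate (other i) * ?h (Arrive (other i)) + mu * ?h Complete) / (lam + mu)"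
    using lam mu by (simp add: add_divide_distrib[symmetric] eq_divide_eq mult.commute)
  moreover have "0 \<le> cost_rate c d i z"
    using assms by (cases rule: waiting_cases) auto
  ultimately show ?thesis
    using lam mu rate_nonneg cost_to_go_nonneg[OF assms(2,3)]
    by (subst nn_integral_event[where i=i]) (auto simp: ennreal_plus[symmetric] simp del: ennreal_plus tagged_step.simps)
qed

text \<open>An arrival multiplies the potential by at most \<open>\<theta>\<close>, and a completion
  divides it by at least \<open>\<theta>\<close>; the value 0 after her departure only
  helps.\<close>

lemma potential_step:
  assumes "waiting i z" and \<theta>: "1 < \<theta>"
  shows "(\<integral>\<^sup>+e. ennreal (potential \<theta> i (tagged_step i e z)) \<partial>E)
    \<le> ennreal ((lam * \<theta> + mu / \<theta>) / (lam + mu) * potential \<theta> i z)"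
proof -
  let ?g = "\<lambda>e. potential \<theta> i (tagged_step i e z)"
  have rates: "rate i = lam - rate (other i)" using rate_other[of i] by simp
  have "rate i * ?g (Arrive i) + rate (other i) * ?g (Arrive (other i)) + mu * ?g Complete
      \<le> (lam * \<theta> + mu / \<theta>) * potential \<theta> i z"
    using assms(1)
  proof (cases rule: waiting_cases)
    case (served n k)
    have "?g Complete \<le> \<theta> ^ k"
      unfolding served(1) using served(2) \<theta>
      by (cases "k = 0") (auto simp: potential_def tagged_step_served simp del: tagged_step.simps)
    then have "mu * ?g Complete \<le> mu / \<theta> * \<theta> ^ Suc k" using mu \<theta> by simp
    moreover have "rate i * ?g (Arrive i) + rate (other i) * ?g (Arrive (other i)) = lam * \<theta> ^ Suc k"
      using served unfolding rates
      by (simp add: potential_def tagged_step_served algebra_simps del: tagged_step.simps)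
    moreover have "lam * \<theta> ^ Suc k \<le> lam * \<theta> * \<theta> ^ Suc k"
      using lam \<theta> by (intro mult_right_mono) auto
    ultimately show ?thesis using served by (simp add: potential_def ring_distribs)
  next
    case (delayed n k)
    obtain m where m: "n (other i) = Suc m" using delayed(3) by (metis gr0_conv_Suc)
    define y where "y = \<theta> ^ Suc k * \<theta> ^ Suc m"
    have y: "potential \<theta> i z = y" "?g (Arrive i) = y" "?g (Arrive (other i)) = \<theta> * y" "\<theta> * ?g Complete = y"
      using delayed m
      by (auto simp: potential_def tagged_step_delayed y_def simp del: tagged_step.simps)
    have "0 \<le> y" using \<theta> by (simp add: y_def)
    then have "rate i * y \<le> rate i * \<theta> * y"
      using rate_nonneg[of i] \<theta> by (intro mult_right_mono) (auto simp: mult_le_cancel_left1)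
    moreover have "?g Complete = y / \<theta>" using y(4) \<theta> by (simp add: field_simps)
    ultimately show ?thesis unfolding y unfolding rates by (simp add: algebra_simps)
  qed
  then show ?thesis
    using lam mu \<theta> potential_nonneg[of \<theta> i]
    by (subst nn_integral_event[where i=i]) (auto intro!: ennreal_leI divide_right_mono simp del: tagged_step.simps)
qed

text \<open>Bernoulli's inequality bounds \<open>m\<close> by
  \<open>\<theta> ^ m / (\<theta> - 1)\<close>, applied to the position and to the length of the
  other queue.\<close>

lemma cost_to_go_le_potential:
  assumes "0 \<le> c" "0 \<le> d" and \<theta>: "1 < \<theta>"
  shows "cost_to_go c d i z \<le> (c / mu + d / (mu - rate (other i))) / (\<theta> - 1) * potential \<theta> i z"
proof (cases "snd z")
  case None
  then show ?thesis by (simp add: cost_to_go_def potential_def)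
next
  case (Some k)
  have gap: "0 < mu - rate (other i)" using rate_less[of "other i"] by simp
  have bern: "real m \<le> \<theta> ^ m / (\<theta> - 1)" for m
    using Bernoulli_inequality[of "\<theta> - 1" m] \<theta> by (simp add: field_simps)
  let ?y = "if fst (fst z) = i then 1 else \<theta> ^ snd (fst z) (other i)"
  have y: "1 \<le> ?y" "1 \<le> \<theta> ^ Suc k" using \<theta> by (auto simp del: power_Suc intro: one_le_power)
  have 1: "real (Suc k) \<le> (\<theta> ^ Suc k * ?y) / (\<theta> - 1)"
  proof -
    have "\<theta> ^ Suc k / (\<theta> - 1) \<le> (\<theta> ^ Suc k * ?y) / (\<theta> - 1)"
      using mult_left_mono[OF y(1), of "\<theta> ^ Suc k"] y(2) \<theta>
      by (intro divide_right_mono) (auto simp del: power_Suc)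
    with bern[of "Suc k"] show ?thesis by linarith
  qed
  have 2: "(if fst (fst z) = i then 0 else real (snd (fst z) (other i))) \<le> (\<theta> ^ Suc k * ?y) / (\<theta> - 1)"
  proof (cases "fst (fst z) = i")
    case True
    then show ?thesis using y \<theta> by (simp del: power_Suc)
  next
    case False
    have "real (snd (fst z) (other i)) \<le> ?y / (\<theta> - 1)" using bern False by simp
    also have "\<dots> \<le> (\<theta> ^ Suc k * ?y) / (\<theta> - 1)"
      using mult_right_mono[OF y(2), of ?y] y(1) \<theta> by (intro divide_right_mono) auto
    finally show ?thesis using False by simp
  qed
  have "cost_to_go c d i z = c / mu * real (Suc k)
      + d / (mu - rate (other i)) * (if fst (fst z) = i then 0 else real (snd (fst z) (other i)))"
    using Some by (simp add: cost_to_go_def add.commute)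
  also have "\<dots> \<le> c / mu * ((\<theta> ^ Suc k * ?y) / (\<theta> - 1)) + d / (mu - rate (other i)) * ((\<theta> ^ Suc k * ?y) / (\<theta> - 1))"
    using assms gap mu by (intro add_mono mult_left_mono[OF 1] mult_left_mono[OF 2]) auto
  also have "\<dots> = (c / mu + d / (mu - rate (other i))) / (\<theta> - 1) * potential \<theta> i z"
    using Some unfolding potential_def by (simp only: option.case times_divide_eq_right ring_distribs add_divide_distrib times_divide_eq_left)
  finally show ?thesis .
qed

text \<open>Any \<open>\<theta>\<close> strictly between 1 and \<open>mu / lam\<close> works,
  because the deficit of \<open>lam * \<theta> + mu / \<theta>\<close> from \<open>lam + mu\<close>
  factors.\<close>

lemma contraction_exists:
  obtains \<theta> where "1 < \<theta>" "(lam * \<theta> + mu / \<theta>) / (lam + mu) < 1"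
proof -
  obtain \<theta> where \<theta>: "1 < \<theta>" "\<theta> < mu / lam"
    using dense[of 1 "mu / lam"] lam lam_mu by auto
  have "0 < (\<theta> - 1) * (mu / \<theta> - lam)"
    using \<theta> lam by (intro mult_pos_pos) (simp_all add: field_simps)
  also have "\<dots> = lam + mu - (lam * \<theta> + mu / \<theta>)" using \<theta> by (simp add: field_simps)
  finally have "lam * \<theta> + mu / \<theta> < lam + mu" by simp
  then show ?thesis using that \<theta> lam mu by simp
qed

text \<open>A nonnegative solution of the first-step equation is in general only an upper bound for
  the cost. Iterating it \<open>n\<close> times leaves a remainder of at most
  \<open>C * \<beta> ^ n\<close> times the potential, which tends to 0 and forces equality.\<close>

lemma mean_total_cost_eq:
  assumes z: "waiting i z" and cd: "0 \<le> c" "0 \<le> d"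
  shows "(\<integral>\<^sup>+w. total_cost c d i z w \<partial>stream_space D) = ennreal (cost_to_go c d i z)"
proof -
  obtain \<theta> where \<theta>: "1 < \<theta>" "(lam * \<theta> + mu / \<theta>) / (lam + mu) < 1" by (rule contraction_exists)
  define \<beta> where "\<beta> = (lam * \<theta> + mu / \<theta>) / (lam + mu)"
  define C where "C = (c / mu + d / (mu - rate (other i))) / (\<theta> - 1)"
  have \<beta>: "0 \<le> \<beta>" "\<beta> < 1" using \<theta> lam mu by (auto simp: \<beta>_def)
  have C: "0 \<le> C" using cd mu rate_less[of "other i"] \<theta> by (simp add: C_def)
  let ?P = "\<lambda>n z. \<Sum>k<n. mean_stage_cost c d i k z"
  have "\<exists>R. ennreal (cost_to_go c d i z) = ?P n z + R \<and> R \<le> ennreal (C * \<beta> ^ n * potential \<theta> i z)"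
    if "snd z = None \<or> waiting i z" for n z
    using that
  proof (induction n arbitrary: z)
    case 0
    then show ?case
      using cost_to_go_le_potential[OF cd \<theta>(1), of i z] by (auto simp: C_def intro!: ennreal_leI)
  next
    case (Suc n)
    show ?case
    proof (cases "snd z")
      case None
      then show ?thesis by (intro exI[of _ 0]) (simp add: cost_to_go_def mean_stage_cost_left)
    next
      case (Some k)
      with Suc.prems have z: "waiting i z" by simp
      have "\<forall>e. \<exists>R. ennreal (cost_to_go c d i (tagged_step i e z)) = ?P n (tagged_step i e z) + R
          \<and> R \<le> ennreal (C * \<beta> ^ n * potential \<theta> i (tagged_step i e z))"
        using Suc.IH waiting_tagged_step[OF z] by blast
      then obtain R where R:
        "\<And>e. ennreal (cost_to_go c d i (tagged_step i e z)) = ?P n (tagged_step i e z) + R e"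
        "\<And>e. R e \<le> ennreal (C * \<beta> ^ n * potential \<theta> i (tagged_step i e z))"
        by metis
      have "?P (Suc n) z = ennreal (cost_rate c d i z / (lam + mu))
          + (\<Sum>k<n. \<integral>\<^sup>+e. mean_stage_cost c d i k (tagged_step i e z) \<partial>E)"
        unfolding sum.lessThan_Suc_shift by (simp add: mean_stage_cost_0[OF z cd] mean_stage_cost_Suc[OF z])
      also have "(\<Sum>k<n. \<integral>\<^sup>+e. mean_stage_cost c d i k (tagged_step i e z) \<partial>E)
          = (\<integral>\<^sup>+e. ?P n (tagged_step i e z) \<partial>E)"
        by (rule nn_integral_sum[symmetric]) simp
      finally have "?P (Suc n) z + (\<integral>\<^sup>+e. R e \<partial>E) = ennreal (cost_rate c d i z / (lam + mu))
          + (\<integral>\<^sup>+e. ennreal (cost_to_go c d i (tagged_step i e z)) \<partial>E)"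
        unfolding R(1) by (simp add: nn_integral_add add.assoc)
      also have "\<dots> = ennreal (cost_to_go c d i z)"
        using cost_to_go_step[OF z cd] by simp
      finally have 1: "ennreal (cost_to_go c d i z) = ?P (Suc n) z + (\<integral>\<^sup>+e. R e \<partial>E)" by simp
      have "(\<integral>\<^sup>+e. R e \<partial>E) \<le> (\<integral>\<^sup>+e. ennreal (C * \<beta> ^ n) * ennreal (potential \<theta> i (tagged_step i e z)) \<partial>E)"
        using R(2) C \<beta> \<theta> by (intro nn_integral_mono) (simp add: ennreal_mult[symmetric] potential_nonneg)
      also have "\<dots> \<le> ennreal (C * \<beta> ^ n) * ennreal (\<beta> * potential \<theta> i z)"
        using potential_step[OF z \<theta>(1)] by (subst nn_integral_cmult) (auto simp: \<beta>_def intro!: mult_left_mono)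
      also have "\<dots> = ennreal (C * \<beta> ^ Suc n * potential \<theta> i z)"
        using C \<beta> \<theta> by (simp add: ennreal_mult[symmetric] potential_nonneg mult_ac)
      finally show ?thesis using 1 by blast
    qed
  qed
  then obtain R where R: "\<And>n. ennreal (cost_to_go c d i z) = ?P n z + R n"
    "\<And>n. R n \<le> ennreal (C * \<beta> ^ n * potential \<theta> i z)"
    using z by metis
  have "(\<lambda>n. ennreal (C * \<beta> ^ n * potential \<theta> i z)) \<longlonglongrightarrow> ennreal (C * 0 * potential \<theta> i z)"
    using \<beta> by (intro tendsto_ennrealI tendsto_mult tendsto_const LIMSEQ_power_zero) auto
  then have lim: "(\<lambda>n. ennreal (C * \<beta> ^ n * potential \<theta> i z)) \<longlonglongrightarrow> 0" by simp
  have "R \<longlonglongrightarrow> 0"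
    by (rule tendsto_sandwich[OF _ _ tendsto_const lim]) (simp_all add: R(2))
  moreover have "(\<lambda>n. ?P n z) \<longlonglongrightarrow> (\<Sum>k. mean_stage_cost c d i k z)"
    by (rule summable_LIMSEQ) simp
  ultimately have "(\<lambda>n. ?P n z + R n) \<longlonglongrightarrow> (\<Sum>k. mean_stage_cost c d i k z) + 0"
    by (intro tendsto_add)
  then show ?thesis
    unfolding mean_total_cost R(1)[symmetric] by (simp add: LIMSEQ_const_iff)
qed

end

section \<open>The cost as a function of the policy\<close>

context polling
begin

text \<open>After her arrival the state is settled and nonempty, so the server's queue is nonempty;
  the customers ahead of her are those she found in queue \<open>i\<close>.\<close>

lemma waiting_join: "waiting i (join i x)"
  by (cases x; cases "fst x = i") (auto simp: waiting_def eq_other_iff[symmetric])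

text \<open>Joining moves the server only if it stands at an empty other queue; in that case the
  delay term is 0 on both sides.\<close>

lemma cost_to_go_join:
  assumes "settled x"
  shows "cost_to_go c d i (join i x) = c / mu * (real (snd x i) + 1)
    + d / (mu - rate (other i)) * (of_bool (fst x = other i) * real (snd x (other i)))"
proof -
  obtain s n where x: "x = (s, n)" by (cases x)
  show ?thesis
    using assms by (cases "s = i"; cases "n (other i)")
      (auto simp: x settled_def cost_to_go_def eq_other_iff)
qed

lemma queue_cost_eq:
  assumes cd: "0 \<le> c" "0 \<le> d"
  shows "queue_cost lam mu c d i p = ennreal (c / mu * (mean_busy i + mean_idle i + 1)
    + d / (mu - rate (other i)) * mean_busy (other i))"
proof -
  have gap: "0 < mu - rate (other i)" using rate_less[of "other i"] by simp
  let ?h = "\<lambda>x. c / mu * (real (snd x i) + 1)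
    + d / (mu - rate (other i)) * (of_bool (fst x = other i) * real (snd x (other i)))"
  have "queue_cost lam mu c d i p = (\<integral>\<^sup>+x. ennreal (cost_to_go c d i (join i x)) \<partial>S)"
    unfolding queue_cost_def by (simp add: mean_total_cost_eq[OF waiting_join cd])
  also have "\<dots> = (\<integral>\<^sup>+x. ennreal (?h x) \<partial>S)"
    by (intro nn_integral_cong_AE AE_pmfI) (simp only: cost_to_go_join[OF steady_state_settled])
  also have "\<dots> = ennreal (\<integral>x. ?h x \<partial>S)"
    using cd mu gap integrable_queue integrable_busy by (intro nn_integral_eq_integral) auto
  also have "(\<integral>x. ?h x \<partial>S) = c / mu * ((\<integral>x. real (snd x i) \<partial>S) + 1) + d / (mu - rate (other i)) * mean_busy (other i)"
    unfolding mean_busy_def using integrable_queue integrable_busy by simp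
  finally show ?thesis by (simp add: mean_queue)
qed

definition mean_cost :: "real \<Rightarrow> real \<Rightarrow> real" where
  "mean_cost c d = c / (mu - lam) + (d - c) * (mean_idle Q1 + mean_idle Q2) / lam"

lemma mean_nonneg: "0 \<le> mean_busy i" "0 \<le> mean_idle i"
  by (simp_all add: mean_busy_def mean_idle_def)

lemma
  shows mean_total: "mean_busy Q1 + mean_busy Q2 + mean_idle Q1 + mean_idle Q2 = lam / (mu - lam)"
    and mean_idle_sum: "mean_idle Q1 + mean_idle Q2 = lam\<^sup>2 * (p * (1 - p)) * (mu\<^sup>2 + (mu - lam)\<^sup>2)
      / (mu * (mu - lam) * (mu * (mu - lam) + 2 * (lam\<^sup>2 * (p * (1 - p)))))"
proof -
  have sum: "rate Q1 + rate Q2 = lam" by (simp add: algebra_simps)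
  have prod: "rate Q1 * rate Q2 = lam\<^sup>2 * (p * (1 - p))" by (simp add: power2_eq_square)
  have "rate Q1 + rate Q2 < mu" using sum lam_mu by simp
  from two_queue_moments[OF rate_nonneg rate_nonneg this mean_busy_eq mean_busy_eq
      mean_idle_eq[of Q1, simplified other.simps] mean_idle_eq[of Q2, simplified other.simps]]
  show "mean_busy Q1 + mean_busy Q2 + mean_idle Q1 + mean_idle Q2 = lam / (mu - lam)"
    "mean_idle Q1 + mean_idle Q2 = lam\<^sup>2 * (p * (1 - p)) * (mu\<^sup>2 + (mu - lam)\<^sup>2)
      / (mu * (mu - lam) * (mu * (mu - lam) + 2 * (lam\<^sup>2 * (p * (1 - p)))))"
    unfolding sum prod .
qed

text \<open>By Little's law the cost splits into the two time averages of customers in the busy and in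
  the idle queue, whose sum does not depend on the policy.\<close>

lemma expected_cost_eq:
  assumes cd: "0 \<le> c" "0 \<le> d"
  shows "expected_cost lam mu c d p = ennreal (mean_cost c d)" "0 \<le> mean_cost c d"
proof -
  let ?X = "\<lambda>i. c / mu * (mean_busy i + mean_idle i + 1) + d / (mu - rate (other i)) * mean_busy (other i)"
  have gap: "0 < mu - rate i" for i using rate_less[of i] by simp
  have X_0: "0 \<le> ?X i" for i
    using cd mu gap[of "other i"] mean_nonneg
    by (intro add_nonneg_nonneg mult_nonneg_nonneg divide_nonneg_nonneg) (auto simp: add_nonneg_nonneg)
  \<comment> \<open>Little's law for queue \<open>i\<close>: \<open>mean_busy_eq\<close> converts
    the time in the busy queue and \<open>mean_idle_eq\<close> the time in the idle queue into mean
    numbers of customers divided by \<open>lam\<close>.\<close>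
  have X: "queue_prob p i * ?X i = (c * mean_busy i + d * mean_idle i) / lam" for i
  proof -
    have "queue_prob p i * (c / mu * (mean_busy i + mean_idle i + 1)) = c * mean_busy i / lam"
      using mean_busy_eq[of i] lam mu by (simp add: field_simps)
    moreover have "queue_prob p i * (d / (mu - rate (other i)) * mean_busy (other i)) = d * mean_idle i / lam"
    proof -
      have "lam * (queue_prob p i * mean_busy (other i)) = (mu - rate (other i)) * mean_idle i"
        using mean_idle_eq[of i] by simp
      then have "queue_prob p i * mean_busy (other i) / (mu - rate (other i)) = mean_idle i / lam"
        using lam gap[of "other i"] by (simp add: divide_eq_eq eq_divide_eq mult.commute)
      then show ?thesis by (metis times_divide_eq_left times_divide_eq_right mult.commute mult.left_commute)
    qed
    ultimately show ?thesis by (simp add: ring_distribs add_divide_distrib)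
  qed
  have "p * ?X Q1 + (1 - p) * ?X Q2
      = (c * (mean_busy Q1 + mean_busy Q2 + mean_idle Q1 + mean_idle Q2)
          + (d - c) * (mean_idle Q1 + mean_idle Q2)) / lam"
    using X[of Q1] X[of Q2] by (simp add: add_divide_distrib[symmetric] algebra_simps)
  also have "\<dots> = mean_cost c d"
    unfolding mean_total mean_cost_def using lam by (simp add: add_divide_distrib)
  finally have eq: "p * ?X Q1 + (1 - p) * ?X Q2 = mean_cost c d" .
  have "expected_cost lam mu c d p = ennreal (p * ?X Q1 + (1 - p) * ?X Q2)"
    unfolding expected_cost_def queue_cost_eq[OF cd]
    using p X_0[of Q1] X_0[of Q2] by (simp only: ennreal_mult[symmetric] ennreal_plus[symmetric] mult_nonneg_nonneg diff_ge_0_iff_ge)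
  then show "expected_cost lam mu c d p = ennreal (mean_cost c d)" unfolding eq .
  show "0 \<le> mean_cost c d"
    unfolding eq[symmetric] using p X_0[of Q1] X_0[of Q2] by simp
qed

end

section \<open>Monotonicity of the cost in \<open>p * (1 - p)\<close> and the optimal
  policies\<close>

lemma idle_formula_le_iff:
  fixes M k a s t :: real
  assumes "0 < M" "0 < k" "0 < a" "0 \<le> s" "0 \<le> t"
  shows "a * s * k / (M * (M + 2 * (a * s))) \<le> a * t * k / (M * (M + 2 * (a * t))) \<longleftrightarrow> s \<le> t"
proof -
  have pos: "0 < M * (M + 2 * (a * x))" if "0 \<le> x" for x
    using assms that by (intro mult_pos_pos add_pos_nonneg) auto
  have frac: "x / u \<le> y / v \<longleftrightarrow> x * v \<le> y * u" if "0 < u" "0 < v" for x y u v :: real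
    using that by (simp add: field_simps)
  have "a * s * k / (M * (M + 2 * (a * s))) \<le> a * t * k / (M * (M + 2 * (a * t)))
    \<longleftrightarrow> a * s * k * (M * (M + 2 * (a * t))) \<le> a * t * k * (M * (M + 2 * (a * s)))"
    using assms by (intro frac pos)
  \<comment> \<open>After cross-multiplication the terms containing the product \<open>s * t\<close>
    agree on both sides and cancel.\<close>
  also have "\<dots> \<longleftrightarrow> 0 \<le> (a * k * M * M) * (t - s)" by (simp add: algebra_simps)
  also have "\<dots> \<longleftrightarrow> s \<le> t"
  proof -
    have "0 < a * k * M * M" using assms by simp
    then show ?thesis by (subst zero_le_mult_iff) auto
  qed
  finally show ?thesis .
qed

text \<open>Among the terms of \<open>mean_cost\<close> only the mean number of customers in the
  idle queue depends on the policy, and the sign of \<open>d - c\<close> decides the direction of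
  the comparison.\<close>

lemma expected_cost_le_iff:
  fixes lam mu c d p q :: real
  assumes "0 < lam" "lam < mu" "0 \<le> c" "0 \<le> d" "p \<in> {0..1}" "q \<in> {0..1}"
  shows "expected_cost lam mu c d p \<le> expected_cost lam mu c d q
    \<longleftrightarrow> (d < c \<longrightarrow> q * (1 - q) \<le> p * (1 - p)) \<and> (c < d \<longrightarrow> p * (1 - p) \<le> q * (1 - q))"
proof -
  interpret P: polling lam mu p using assms by unfold_locales auto
  interpret Q: polling lam mu q using assms by unfold_locales auto
  let ?L = "\<lambda>p. polling.mean_idle lam mu p Q1 + polling.mean_idle lam mu p Q2"
  have L: "?L x \<le> ?L y \<longleftrightarrow> x * (1 - x) \<le> y * (1 - y)" if "x \<in> {0..1}" "y \<in> {0..1}" for x y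
  proof -
    interpret X: polling lam mu x using assms that by unfold_locales auto
    interpret Y: polling lam mu y using assms that by unfold_locales auto
    have "0 < mu\<^sup>2 + (mu - lam)\<^sup>2" using X.mu by (intro add_pos_nonneg) auto
    then show ?thesis
      unfolding X.mean_idle_sum Y.mean_idle_sum using assms that X.mu
      by (intro idle_formula_le_iff) auto
  qed
  have "expected_cost lam mu c d p \<le> expected_cost lam mu c d q \<longleftrightarrow> P.mean_cost c d \<le> Q.mean_cost c d"
    using P.expected_cost_eq[of c d] Q.expected_cost_eq[of c d] assms by (simp add: ennreal_le_iff)
  also have "\<dots> \<longleftrightarrow> (d - c) * ?L p \<le> (d - c) * ?L q"
    unfolding P.mean_cost_def Q.mean_cost_def using assms by (simp add: divide_le_cancel)
  also have "\<dots> \<longleftrightarrow> (d < c \<longrightarrow> ?L q \<le> ?L p) \<and> (c < d \<longrightarrow> ?L p \<le> ?L q)"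
    by (auto simp: mult_le_cancel_left)
  finally show ?thesis using L assms by simp
qed

theorem theorem3p2:
  fixes lam mu c d :: real
  assumes "lam > 0" and "mu > 0" and "lam / mu < 1"
    and "c > 0" and "d \<ge> 0"
  shows "(c > d \<longrightarrow> {p. socially_optimal lam mu c d p} = {1/2}) \<and>
         (c = d \<longrightarrow> {p. socially_optimal lam mu c d p} = {0..1}) \<and>
         (c < d \<longrightarrow> {p. socially_optimal lam mu c d p} = {0, 1})"
proof -
  have "lam < mu" using assms by simp
  then have opt: "socially_optimal lam mu c d p \<longleftrightarrow> p \<in> {0..1} \<and> (\<forall>q\<in>{0..1}.
      (d < c \<longrightarrow> q * (1 - q) \<le> p * (1 - p)) \<and> (c < d \<longrightarrow> p * (1 - p) \<le> q * (1 - q)))" for p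
    unfolding socially_optimal_def using assms by (auto simp: expected_cost_le_iff)
  \<comment> \<open>Completing the square gives the unique maximizer 1/2, needed for
    \<open>c > d\<close>. For \<open>c < d\<close> the comparison policy is 0, where
    \<open>q * (1 - q)\<close> takes its minimum 0.\<close>
  have quarter: "q * (1 - q) \<le> 1/4" "1/4 \<le> q * (1 - q) \<longleftrightarrow> q = 1/2" for q :: real
  proof -
    have eq: "q * (1 - q) = 1/4 - (q - 1/2)\<^sup>2" by (simp add: power2_eq_square field_simps)
    show "q * (1 - q) \<le> 1/4" "1/4 \<le> q * (1 - q) \<longleftrightarrow> q = 1/2" unfolding eq by auto
  qed
  show ?thesis
  proof (intro conjI impI)
    assume "c > d"
    have "socially_optimal lam mu c d p \<longleftrightarrow> p = 1/2" for p
    proof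
      assume "socially_optimal lam mu c d p"
      then have "1/4 \<le> p * (1 - p)" using \<open>c > d\<close> by (auto simp: opt dest: bspec[of _ _ "1/2"])
      then show "p = 1/2" using quarter(2) by simp
    next
      assume p: "p = 1/2"
      have pp: "p * (1 - p) = 1/4" by (simp add: p)
      show "socially_optimal lam mu c d p"
        unfolding opt pp
      proof (intro conjI ballI impI)
        show "p \<in> {0..1}" by (simp add: p)
        show "q * (1 - q) \<le> 1/4" for q :: real by (rule quarter)
        show "1/4 \<le> q * (1 - q)" if "c < d" for q :: real using that \<open>c > d\<close> by simp
      qed
    qed
    then show "{p. socially_optimal lam mu c d p} = {1/2}" by blast
  next
    assume "c = d"
    then have "socially_optimal lam mu c d p \<longleftrightarrow> p \<in> {0..1}" for p unfolding opt by simp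
    then show "{p. socially_optimal lam mu c d p} = {0..1}" by blast
  next
    assume "c < d"
    have "socially_optimal lam mu c d p \<longleftrightarrow> p = 0 \<or> p = 1" for p
    proof
      assume "socially_optimal lam mu c d p"
      then have "0 \<le> p" "p \<le> 1" "p * (1 - p) \<le> 0" using \<open>c < d\<close> by (auto simp: opt dest: bspec[of _ _ 0])
      then show "p = 0 \<or> p = 1" by (auto simp: mult_le_0_iff)
    qed (use \<open>c < d\<close> in \<open>auto simp: opt\<close>)
    then show "{p. socially_optimal lam mu c d p} = {0, 1}" by blast
  qed
qed

end
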